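(* Let $q\ge 1$, $\mu\ge 0$, let $(\gamma_1,\gamma_2,\kappa_1,\kappa_2)$ be one of the four admissible boundary parameter sets $$(0,1,1,0),\quad (1,1,0,0),\quad (0,0,1,1),\quad (1,0,0,1),$$ and let $\alpha_1,\alpha_2,\nu_1,\nu_2\in\mathbb{R}$ and $\beta_1,\beta_2,\tau_1,\tau_2\in\mathbb R$ be flux parameters. Let $(u_h,v_h,w_h)$, with $u_h(\cdot,t),v_h(\cdot,t),w_h(\cdot,t)\in V_h^q$ continuously differentiable in $t\ge 0$, be a solution of the semi-discrete local energy-based discontinuous Galerkin scheme described in the context, with the interelement fluxes and the physical boundary fluxes given there. Let $$E^h(t)=\sum_K E^h_K(t),\qquad E^h_K(t)=\int_K \tfrac12 v_h^2+\tfrac12 w_h^2+\tfrac12 u_h^2\,d\mathbf{x}+\sum_{\mathbf{j}}\omega_{\mathbf{j},K}F\big(u_h(\mathbf{x}_{\mathbf{j},K},t)\big).$$ Then $$\frac{dE^h}{dt}=-\sum_K\int_K\mu v_h^2\,d\mathbf{x}-\sum_F\int_F \tau_1[[v_h]]^2+\beta_1[[\nabla w_h]]^2+\beta_2[[w_h]]^2+\tau_2[[\nabla v_h]]^2\,dS-\sum_B\int_B \nu_1(\kappa_1^2-\gamma_1^2)\zeta_1^2+\nu_2(\gamma_2^2-\kappa_2^2)\zeta_2^2\,dS,$$ where $F$ ranges over the interelement (interior) faces, $B$ over the element faces on the physical boundary $\partial\Omega$, and $\zeta_1=\gamma_1\nabla v_h\cdot\mathbf{n}+\kappa_1w_h$,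 $\zeta_2=\gamma_2v_h-\kappa_2\nabla w_h\cdot\mathbf{n}$. Moreover, if $\tau_1,\beta_1,\tau_2,\beta_2\ge 0$ and $\nu_1,\nu_2$ are chosen such that $$\nu_1(\kappa_1^2-\gamma_1^2)\ge 0,\qquad \nu_2(\gamma_2^2-\kappa_2^2)\ge 0,$$ then $E^h(t)\le E^h(0)$ for all $t\ge 0$.
   Context: **Continuous problem.** The scheme discretizes the fourth-order semilinear wave equation $u_{tt}+\Delta^2u+u+\mu u_t+f(u)=0$ on $\Omega\times[0,\infty)$, written as the system $u_t=v$, $w_t=\Delta v$, $v_t=-\Delta w-u-\mu v-f(u)$ (so $w=\Delta u$). Here $\mu\ge0$ is constant, $f:\mathbb{R}\to\mathbb{R}$ is smooth with $f(0)=0$ and $\lim_{u\to0}f(u)/u$ bounded; the quotient $f(u)/u$ is understood at $u=0$ as its limit. $F$ (as a function) is an antiderivative of $f$, $F'=f$, with $F\ge0$. **Mesh and spaces.** $\Omega\subset\mathbb{R}^d$, $d\in\{1,2\}$, is bounded and tessellated by a mesh $\Omega_h$ of shape-regular elements $K$: for $d=1$, intervals $K=(x_{j-1/2},x_{j+1/2})$; for $d=2$, rectangles $K=(x_{k-1/2},x_{k+1/2})\times(y_{j-1/2},y_{j+1/2})$ of a Cartesian grid. $h_K$ is the diameter of $K$ and $h=\max_Kh_K$. $V_h^q$ is the space of functions whose restriction to every $K$ belongs to $\mathcal{Q}^q(K)$, the tensor-product polynomials of degree at most $q$ in each variable. There is no continuity requirement across elements. $\mathbf{n}$ denotes the outward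 unit normal of $\partial K$ (of $\partial \Omega$ on boundary faces). For $d=1$, $\nabla$ is $d/dx$, $\mathbf n=\pm1$, and integrals over faces are point evaluations. **Traces, averages, jumps.** An interior face is shared by a "left" element $K_L$ and a "right" element $K_R$ (left/bottom is "left", right/top is "right"), with outward unit normals $\mathbf{n}_L$, $\mathbf{n}_R=-\mathbf{n}_L$. $\eta^-$ and $\eta^+$ are the traces from $K_L$ and $K_R$. For scalar $\eta$ and vector $\boldsymbol\eta$ and $\alpha\in\mathbb{R}$: $\{\{\eta\}\}_\alpha=\alpha\eta^++(1-\alpha)\eta^-$, $[[\eta]]=\eta^-\mathbf{n}_L+\eta^+\mathbf{n}_R$; $\{\{\boldsymbol\eta\}\}_\alpha=\alpha\boldsymbol\eta^++(1-\alpha)\boldsymbol\eta^-$, $[[\boldsymbol\eta]]=\boldsymbol\eta^-\cdot\mathbf{n}_L+\boldsymbol\eta^+\cdot\mathbf{n}_R$. For $d=1$, $[[\eta]]=\eta^--\eta^+$. The square of a vector jump is its squared Euclidean norm. **Quadrature.** On each $K$ there is a quadrature rule with nodes $\mathbf{x}_{\mathbf{j},K}$ in $K$ and weights $\omega_{\mathbf{j},K}>0$ such that, for all $K$ and $\phi\in\mathcal{Q}^q(K)$, $\sum_{\mathbf{j}}\omega_{\mathbf{j},K}\phi^2(\mathbf{x}_{\mathbf{j},K})=\int_K\phi^2\,d\mathbf{x}$, and, for all $\phi\in V_h^q$ and $g\in H^{q+1}(\Omega_h)$ (broken Sobolev space), $\sum_K\big|\sum_{\mathbf{j}}\omega_{\mathbf{j},K}\phi(\mathbf{x}_{\mathbf{j},K})g(\mathbf{x}_{\mathbf{j},K})-\int_K\phi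 g\,d\mathbf{x}\big|\le Ch^{q+1}\|\phi\|_{L^2(\Omega_h)}|g|_{H^{q+1}(\Omega_h)}$ with $C$ independent of $h$. **Scheme.** For every $K$, every $\phi_u,\phi_v,\phi_w\in V_h^q$ and every $t\ge 0$: $$\int_K\phi_u(u_{ht}-v_h)\,d\mathbf{x}+\sum_{\mathbf{j}}\omega_{\mathbf{j},K}\frac{f(u_h(\mathbf{x}_{\mathbf{j},K}))}{u_h(\mathbf{x}_{\mathbf{j},K})}\phi_u(\mathbf{x}_{\mathbf{j},K})\big(u_{ht}(\mathbf{x}_{\mathbf{j},K})-v_h(\mathbf{x}_{\mathbf{j},K})\big)=0,$$ $$\int_Kw_{ht}\phi_w\,d\mathbf{x}+\mathcal{B}^1_K(v_h,\phi_w)=0,$$ $$\int_Kv_{ht}\phi_v+u_h\phi_v+\mu v_h\phi_v\,d\mathbf{x}+\sum_{\mathbf{j}}\omega_{\mathbf{j},K}\phi_v(\mathbf{x}_{\mathbf{j},K})f(u_h(\mathbf{x}_{\mathbf{j},K}))+\mathcal{B}^2_K(w_h,\phi_v)=0,$$ with $$\mathcal{B}^1_K(v_h,\phi_w)=\int_K-v_h\Delta\phi_w\,d\mathbf{x}-\int_{\partial K}\phi_w(\nabla v_h)^*\cdot\mathbf{n}-\nabla\phi_w\cdot\mathbf{n}\,v_h^*\,dS,$$ $$\mathcal{B}^2_K(w_h,\phi_v)=\int_Kw_h\Delta\phi_v\,d\mathbf{x}-\int_{\partial K}\nabla\phi_v\cdot\mathbf{n}\,w_h^*-\phi_v(\nabla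 w_h)^*\cdot\mathbf{n}\,dS.$$ **Interelement fluxes.** On interior faces: $v_h^*=\{\{v_h\}\}_{\alpha_1}+\beta_1[[\nabla w_h]]$, $\;w_h^*=\{\{w_h\}\}_{1-\alpha_2}-\tau_2[[\nabla v_h]]$, $\;(\nabla v_h)^*=\{\{\nabla v_h\}\}_{\alpha_2}-\beta_2[[w_h]]$, $\;(\nabla w_h)^*=\{\{\nabla w_h\}\}_{1-\alpha_1}+\tau_1[[v_h]]$. **Physical boundary fluxes.** The boundary conditions are $\gamma_1\nabla u\cdot\mathbf{n}+\kappa_1\Delta u=0$, $\gamma_2u-\kappa_2\nabla\Delta u\cdot\mathbf{n}=0$ on $\partial\Omega$; the four parameter sets $(\gamma_1,\gamma_2,\kappa_1,\kappa_2)$ correspond respectively to sliding $(0,1,1,0)$, clamped $(1,1,0,0)$, free $(0,0,1,1)$, and simply supported $(1,0,0,1)$. On faces in $\partial\Omega$: $v_h^*=v_h-(\gamma_2-\nu_2\kappa_2)\zeta_2$, $\;(\nabla v_h)^*\cdot\mathbf{n}=\nabla v_h\cdot\mathbf{n}-(\gamma_1+\nu_1\kappa_1)\zeta_1$, $\;w_h^*=w_h-(\kappa_1-\nu_1\gamma_1)\zeta_1$, $\;(\nabla w_h)^*\cdot\mathbf{n}=\nabla w_h\cdot\mathbf{n}+(\kappa_2+\nu_2\gamma_2)\zeta_2$, with $\zeta_1,\zeta_2$ as in the claim. *)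

theory Defs
  imports "HOL-Analysis.Analysis"
begin

definition pd :: "'a::euclidean_space \<Rightarrow> ('a \<Rightarrow> real) \<Rightarrow> 'a \<Rightarrow> real" where
  "pd i \<phi> x = frechet_derivative \<phi> (at x) i"

definition grad :: "('a::euclidean_space \<Rightarrow> real) \<Rightarrow> 'a \<Rightarrow> 'a" where
  "grad \<phi> x = (\<Sum>i\<in>Basis. pd i \<phi> x *\<^sub>R i)"

definition laplacian :: "('a::euclidean_space \<Rightarrow> real) \<Rightarrow> 'a \<Rightarrow> real" where
  "laplacian \<phi> x = (\<Sum>i\<in>Basis. pd i (pd i \<phi>) x)"

text \<open>Time derivative on \<open>[0, \<infinity>)\<close>, one-sided at \<open>0\<close>.\<close>

definition dt :: "(real \<Rightarrow> 'a \<Rightarrow> real) \<Rightarrow> real \<Rightarrow> 'a \<Rightarrow> real" where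
  "dt u t x = vector_derivative (\<lambda>s. u s x) (at t within {0..})"

definition smooth :: "('a::euclidean_space \<Rightarrow> real) \<Rightarrow> bool" where
  "smooth \<psi> \<longleftrightarrow> (\<forall>is x. set is \<subseteq> Basis \<longrightarrow> foldr pd is \<psi> differentiable (at x))"

text \<open>An element is stored as the pair \<open>(a, b)\<close> of its lower and upper corners.\<close>

type_synonym 'a cell = "'a \<times> 'a"

definition elem :: "'a::euclidean_space cell \<Rightarrow> 'a set" where
  "elem K = box (fst K) (snd K)"

text \<open>Cells of the tensor grid whose breakpoints in direction \<open>i\<close> form the set \<open>X i\<close>:
  in every direction the two corners are consecutive breakpoints.\<close>

definition grid_cells :: "('a::euclidean_space \<Rightarrow> real set) \<Rightarrow> 'a cell set" where
  "grid_cells X = {(a, b). \<forall>i\<in>Basis. a \<bullet> i \<in> X i \<and> b \<bullet> i \<in> X i \<and> a \<bullet> i < b \<bullet> i \<and>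
     {a \<bullet> i<..<b \<bullet> i} \<inter> X i = {}}"

text \<open>The domain need not be a box: any finite nonempty set of grid cells is allowed.\<close>

definition cartesian_mesh :: "'a::euclidean_space set \<Rightarrow> 'a cell set \<Rightarrow> bool" where
  "cartesian_mesh \<Omega> M \<longleftrightarrow> finite M \<and> M \<noteq> {} \<and>
     (\<exists>X. (\<forall>i\<in>Basis. finite (X i)) \<and> M \<subseteq> grid_cells X) \<and>
     \<Omega> = interior (\<Union>K\<in>M. closure (elem K))"

definition mesh_size :: "'a::euclidean_space cell set \<Rightarrow> real" where
  "mesh_size M = Max ((\<lambda>K. diameter (elem K)) ` M)"

definition shape_regular :: "real \<Rightarrow> 'a::euclidean_space cell set \<Rightarrow> bool" where
  "shape_regular \<sigma> M \<longleftrightarrow>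
     (\<forall>K\<in>M. \<forall>i\<in>Basis. diameter (elem K) \<le> \<sigma> * (snd K \<bullet> i - fst K \<bullet> i))"

text \<open>The face of \<open>K\<close> with outward unit normal \<open>s *\<^sub>R i\<close>, where \<open>s\<close> is \<open>1\<close> or \<open>-1\<close>.\<close>

definition face_level :: "'a::euclidean_space cell \<Rightarrow> 'a \<Rightarrow> real \<Rightarrow> real" where
  "face_level K i s = (if s = 1 then snd K \<bullet> i else fst K \<bullet> i)"

definition face :: "'a::euclidean_space cell \<Rightarrow> 'a \<Rightarrow> real \<Rightarrow> 'a set" where
  "face K i s = {x \<in> cbox (fst K) (snd K). x \<bullet> i = face_level K i s}"

text \<open>The surface measure on the hyperplane \<open>x \<bullet> i = c\<close>: the product of one-dimensional
  Lebesgue measures over the remaining coordinates. In dimension one the product is empty and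
  this is the unit point mass at \<open>c *\<^sub>R i\<close>.\<close>

definition hyperplane_measure :: "'a::euclidean_space \<Rightarrow> real \<Rightarrow> 'a measure" where
  "hyperplane_measure i c =
     distr (\<Pi>\<^sub>M j\<in>Basis - {i}. lborel) borel (\<lambda>y. c *\<^sub>R i + (\<Sum>j\<in>Basis - {i}. y j *\<^sub>R j))"

definition face_integral ::
    "'a::euclidean_space cell \<Rightarrow> 'a \<Rightarrow> real \<Rightarrow> ('a \<Rightarrow> real) \<Rightarrow> real" where
  "face_integral K i s g = (LINT x:face K i s|hyperplane_measure i (face_level K i s). g x)"

definition elem_integral :: "'a::euclidean_space cell \<Rightarrow> ('a \<Rightarrow> real) \<Rightarrow> real" where
  "elem_integral K g = (LINT x:elem K|lborel. g x)"

text \<open>An interior face is a triple \<open>(L, R, i)\<close>: \<open>L\<close> is the left (bottom) and \<open>R\<close> the right (top)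
  element, and the unit normals are \<open>n\<^sub>L = i\<close> and \<open>n\<^sub>R = - i\<close>.\<close>

definition interior_faces ::
    "'a::euclidean_space cell set \<Rightarrow> ('a cell \<times> 'a cell \<times> 'a) set" where
  "interior_faces M = {(L, R, i). L \<in> M \<and> R \<in> M \<and> i \<in> Basis \<and> face L i 1 = face R i (-1)}"

definition boundary_faces ::
    "'a::euclidean_space set \<Rightarrow> 'a cell set \<Rightarrow> ('a cell \<times> 'a \<times> real) set" where
  "boundary_faces \<Omega> M =
     {(K, i, s). K \<in> M \<and> i \<in> Basis \<and> s \<in> {-1, 1} \<and> face K i s \<subseteq> frontier \<Omega>}"

definition neighbour ::
    "'a::euclidean_space cell set \<Rightarrow> 'a cell \<Rightarrow> 'a \<Rightarrow> real \<Rightarrow> 'a cell" where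
  "neighbour M K i s = (THE K'. K' \<in> M \<and> face K' i (- s) = face K i s)"

definition left_elem ::
    "'a::euclidean_space cell set \<Rightarrow> 'a cell \<Rightarrow> 'a \<Rightarrow> real \<Rightarrow> 'a cell" where
  "left_elem M K i s = (if s = 1 then K else neighbour M K i s)"

definition right_elem ::
    "'a::euclidean_space cell set \<Rightarrow> 'a cell \<Rightarrow> 'a \<Rightarrow> real \<Rightarrow> 'a cell" where
  "right_elem M K i s = (if s = 1 then neighbour M K i s else K)"

definition tensor_poly :: "nat \<Rightarrow> ('a::euclidean_space \<Rightarrow> real) set" where
  "tensor_poly q = {p. \<exists>c. \<forall>x. p x =
     (\<Sum>\<alpha>\<in>Basis \<rightarrow>\<^sub>E {..q}. c \<alpha> * (\<Prod>i\<in>Basis. (x \<bullet> i) ^ \<alpha> i))}"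

text \<open>Elements are open, so members of the space carry no condition on the element boundaries.\<close>

definition Vh :: "nat \<Rightarrow> 'a::euclidean_space cell set \<Rightarrow> ('a \<Rightarrow> real) set" where
  "Vh q M = {\<phi>. \<forall>K\<in>M. \<exists>p\<in>tensor_poly q. \<forall>x\<in>elem K. \<phi> x = p x}"

text \<open>Continuously differentiable curves \<open>[0, \<infinity>) \<rightarrow> Vh q M\<close>. The space is finite-dimensional and
  point evaluations in the elements separate its members, so pointwise continuous
  differentiability is the same as continuous differentiability in norm.\<close>

definition C1_curve :: "nat \<Rightarrow> 'a::euclidean_space cell set \<Rightarrow> (real \<Rightarrow> 'a \<Rightarrow> real) \<Rightarrow> bool" where
  "C1_curve q M u \<longleftrightarrow> (\<forall>t\<ge>0. u t \<in> Vh q M \<and> dt u t \<in> Vh q M) \<and>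
     (\<forall>K\<in>M. \<forall>x\<in>elem K. (\<forall>t\<ge>0. (\<lambda>s. u s x) differentiable (at t within {0..})) \<and>
        continuous_on {0..} (\<lambda>t. dt u t x))"

definition tr :: "'a::euclidean_space cell \<Rightarrow> ('a \<Rightarrow> 'b::real_normed_vector) \<Rightarrow> 'a \<Rightarrow> 'b" where
  "tr K \<eta> x = Lim (at x within elem K) \<eta>"

definition avg ::
    "real \<Rightarrow> 'a::euclidean_space cell \<Rightarrow> 'a cell \<Rightarrow> ('a \<Rightarrow> 'b::real_normed_vector) \<Rightarrow> 'a \<Rightarrow> 'b" where
  "avg \<alpha> L R \<eta> x = \<alpha> *\<^sub>R tr R \<eta> x + (1 - \<alpha>) *\<^sub>R tr L \<eta> x"

definition jump ::
    "'a::euclidean_space cell \<Rightarrow> 'a cell \<Rightarrow> 'a \<Rightarrow> ('a \<Rightarrow> real) \<Rightarrow> 'a \<Rightarrow> 'a" where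
  "jump L R i \<eta> x = tr L \<eta> x *\<^sub>R i + tr R \<eta> x *\<^sub>R (- i)"

definition vjump ::
    "'a::euclidean_space cell \<Rightarrow> 'a cell \<Rightarrow> 'a \<Rightarrow> ('a \<Rightarrow> 'a) \<Rightarrow> 'a \<Rightarrow> real" where
  "vjump L R i \<eta> x = tr L \<eta> x \<bullet> i + tr R \<eta> x \<bullet> (- i)"

text \<open>Normal derivative on the face of \<open>K\<close> with outward normal \<open>s *\<^sub>R i\<close>, from inside \<open>K\<close>.\<close>

definition nderiv ::
    "'a::euclidean_space cell \<Rightarrow> 'a \<Rightarrow> real \<Rightarrow> ('a \<Rightarrow> real) \<Rightarrow> 'a \<Rightarrow> real" where
  "nderiv K i s \<eta> x = tr K (grad \<eta>) x \<bullet> (s *\<^sub>R i)"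

record flux_params =
  \<alpha>\<^sub>1 :: real  \<alpha>\<^sub>2 :: real
  \<beta>\<^sub>1 :: real  \<beta>\<^sub>2 :: real
  \<tau>\<^sub>1 :: real  \<tau>\<^sub>2 :: real
  \<gamma>\<^sub>1 :: real  \<gamma>\<^sub>2 :: real
  \<kappa>\<^sub>1 :: real  \<kappa>\<^sub>2 :: real
  \<nu>\<^sub>1 :: real  \<nu>\<^sub>2 :: real

definition zeta1 :: "flux_params \<Rightarrow> 'a::euclidean_space cell \<Rightarrow> 'a \<Rightarrow> real \<Rightarrow>
    ('a \<Rightarrow> real) \<Rightarrow> ('a \<Rightarrow> real) \<Rightarrow> 'a \<Rightarrow> real" where
  "zeta1 P K i s v w x = \<gamma>\<^sub>1 P * nderiv K i s v x + \<kappa>\<^sub>1 P * tr K w x"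

definition zeta2 :: "flux_params \<Rightarrow> 'a::euclidean_space cell \<Rightarrow> 'a \<Rightarrow> real \<Rightarrow>
    ('a \<Rightarrow> real) \<Rightarrow> ('a \<Rightarrow> real) \<Rightarrow> 'a \<Rightarrow> real" where
  "zeta2 P K i s v w x = \<gamma>\<^sub>2 P * tr K v x - \<kappa>\<^sub>2 P * nderiv K i s w x"

text \<open>The fluxes on the face \<open>(K, i, s)\<close>. For the gradients only the component along the outward
  normal of \<open>K\<close> enters the scheme, and on the physical boundary only it is prescribed.\<close>

definition v_star :: "'a::euclidean_space set \<Rightarrow> 'a cell set \<Rightarrow> flux_params \<Rightarrow>
    ('a \<Rightarrow> real) \<Rightarrow> ('a \<Rightarrow> real) \<Rightarrow> 'a cell \<Rightarrow> 'a \<Rightarrow> real \<Rightarrow> 'a \<Rightarrow> real" where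
  "v_star \<Omega> M P v w K i s x =
    (if (K, i, s) \<in> boundary_faces \<Omega> M
     then tr K v x - (\<gamma>\<^sub>2 P - \<nu>\<^sub>2 P * \<kappa>\<^sub>2 P) * zeta2 P K i s v w x
     else let L = left_elem M K i s; R = right_elem M K i s
          in avg (\<alpha>\<^sub>1 P) L R v x + \<beta>\<^sub>1 P * vjump L R i (grad w) x)"

definition w_star :: "'a::euclidean_space set \<Rightarrow> 'a cell set \<Rightarrow> flux_params \<Rightarrow>
    ('a \<Rightarrow> real) \<Rightarrow> ('a \<Rightarrow> real) \<Rightarrow> 'a cell \<Rightarrow> 'a \<Rightarrow> real \<Rightarrow> 'a \<Rightarrow> real" where
  "w_star \<Omega> M P v w K i s x =
    (if (K, i, s) \<in> boundary_faces \<Omega> M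
     then tr K w x - (\<kappa>\<^sub>1 P - \<nu>\<^sub>1 P * \<gamma>\<^sub>1 P) * zeta1 P K i s v w x
     else let L = left_elem M K i s; R = right_elem M K i s
          in avg (1 - \<alpha>\<^sub>2 P) L R w x - \<tau>\<^sub>2 P * vjump L R i (grad v) x)"

definition grad_v_star_n :: "'a::euclidean_space set \<Rightarrow> 'a cell set \<Rightarrow> flux_params \<Rightarrow>
    ('a \<Rightarrow> real) \<Rightarrow> ('a \<Rightarrow> real) \<Rightarrow> 'a cell \<Rightarrow> 'a \<Rightarrow> real \<Rightarrow> 'a \<Rightarrow> real" where
  "grad_v_star_n \<Omega> M P v w K i s x =
    (if (K, i, s) \<in> boundary_faces \<Omega> M
     then nderiv K i s v x - (\<gamma>\<^sub>1 P + \<nu>\<^sub>1 P * \<kappa>\<^sub>1 P) * zeta1 P K i s v w x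
     else let L = left_elem M K i s; R = right_elem M K i s
          in (avg (\<alpha>\<^sub>2 P) L R (grad v) x - \<beta>\<^sub>2 P *\<^sub>R jump L R i w x) \<bullet> (s *\<^sub>R i))"

definition grad_w_star_n :: "'a::euclidean_space set \<Rightarrow> 'a cell set \<Rightarrow> flux_params \<Rightarrow>
    ('a \<Rightarrow> real) \<Rightarrow> ('a \<Rightarrow> real) \<Rightarrow> 'a cell \<Rightarrow> 'a \<Rightarrow> real \<Rightarrow> 'a \<Rightarrow> real" where
  "grad_w_star_n \<Omega> M P v w K i s x =
    (if (K, i, s) \<in> boundary_faces \<Omega> M
     then nderiv K i s w x + (\<kappa>\<^sub>2 P + \<nu>\<^sub>2 P * \<gamma>\<^sub>2 P) * zeta2 P K i s v w x
     else let L = left_elem M K i s; R = right_elem M K i s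
          in (avg (1 - \<alpha>\<^sub>1 P) L R (grad w) x + \<tau>\<^sub>1 P *\<^sub>R jump L R i v x) \<bullet> (s *\<^sub>R i))"

definition B1 :: "'a::euclidean_space set \<Rightarrow> 'a cell set \<Rightarrow> flux_params \<Rightarrow>
    ('a \<Rightarrow> real) \<Rightarrow> ('a \<Rightarrow> real) \<Rightarrow> 'a cell \<Rightarrow> ('a \<Rightarrow> real) \<Rightarrow> real" where
  "B1 \<Omega> M P v w K \<phi> =
     elem_integral K (\<lambda>x. - v x * laplacian \<phi> x)
     - (\<Sum>i\<in>Basis. \<Sum>s\<in>{-1, 1}. face_integral K i s
          (\<lambda>x. tr K \<phi> x * grad_v_star_n \<Omega> M P v w K i s x
             - nderiv K i s \<phi> x * v_star \<Omega> M P v w K i s x))"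

definition B2 :: "'a::euclidean_space set \<Rightarrow> 'a cell set \<Rightarrow> flux_params \<Rightarrow>
    ('a \<Rightarrow> real) \<Rightarrow> ('a \<Rightarrow> real) \<Rightarrow> 'a cell \<Rightarrow> ('a \<Rightarrow> real) \<Rightarrow> real" where
  "B2 \<Omega> M P v w K \<phi> =
     elem_integral K (\<lambda>x. w x * laplacian \<phi> x)
     - (\<Sum>i\<in>Basis. \<Sum>s\<in>{-1, 1}. face_integral K i s
          (\<lambda>x. nderiv K i s \<phi> x * w_star \<Omega> M P v w K i s x
             - tr K \<phi> x * grad_w_star_n \<Omega> M P v w K i s x))"

definition L2_on :: "'a::euclidean_space set \<Rightarrow> ('a \<Rightarrow> real) \<Rightarrow> bool" where
  "L2_on U g \<longleftrightarrow> set_borel_measurable lborel U g \<and> set_integrable lborel U (\<lambda>x. (g x)\<^sup>2)"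

definition test_function :: "'a::euclidean_space set \<Rightarrow> ('a \<Rightarrow> real) \<Rightarrow> bool" where
  "test_function U \<psi> \<longleftrightarrow> smooth \<psi> \<and> compact (closure {x. \<psi> x \<noteq> 0}) \<and> closure {x. \<psi> x \<noteq> 0} \<subseteq> U"

definition multi_indices :: "nat \<Rightarrow> ('a::euclidean_space \<Rightarrow> nat) set" where
  "multi_indices m = {\<alpha> \<in> Basis \<rightarrow>\<^sub>E UNIV. (\<Sum>i\<in>Basis. \<alpha> i) = m}"

text \<open>The derivative of order \<open>\<alpha>\<close> of a test function is computed along any list of directions in
  which each \<open>i\<close> occurs \<open>\<alpha> i\<close> times.\<close>

definition is_weak_deriv :: "'a::euclidean_space set \<Rightarrow> ('a \<Rightarrow> nat) \<Rightarrow> ('a \<Rightarrow> real) \<Rightarrow>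
    ('a \<Rightarrow> real) \<Rightarrow> bool" where
  "is_weak_deriv U \<alpha> g d \<longleftrightarrow>
     (\<forall>\<psi> is. test_function U \<psi> \<and> set is \<subseteq> Basis \<and> (\<forall>i\<in>Basis. count_list is i = \<alpha> i) \<longrightarrow>
        (LINT x:U|lborel. g x * foldr pd is \<psi> x) = (-1) ^ length is * (LINT x:U|lborel. d x * \<psi> x))"

definition weak_deriv ::
    "'a::euclidean_space set \<Rightarrow> ('a \<Rightarrow> nat) \<Rightarrow> ('a \<Rightarrow> real) \<Rightarrow> 'a \<Rightarrow> real" where
  "weak_deriv U \<alpha> g = (SOME d. L2_on U d \<and> is_weak_deriv U \<alpha> g d)"

definition sobolev :: "nat \<Rightarrow> 'a::euclidean_space set \<Rightarrow> ('a \<Rightarrow> real) \<Rightarrow> bool" where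
  "sobolev m U g \<longleftrightarrow> L2_on U g \<and>
     (\<forall>k\<le>m. \<forall>\<alpha>\<in>multi_indices k. \<exists>d. L2_on U d \<and> is_weak_deriv U \<alpha> g d)"

text \<open>Point values enter the quadrature rule, so members are represented by their continuous
  version on each element (it exists for \<open>m \<ge> 2\<close> in dimensions one and two).\<close>

definition broken_sobolev :: "nat \<Rightarrow> 'a::euclidean_space cell set \<Rightarrow> ('a \<Rightarrow> real) set" where
  "broken_sobolev m M = {g. \<forall>K\<in>M. sobolev m (elem K) g \<and> continuous_on (elem K) g}"

definition broken_seminorm :: "nat \<Rightarrow> 'a::euclidean_space cell set \<Rightarrow> ('a \<Rightarrow> real) \<Rightarrow> real" where
  "broken_seminorm m M g = sqrt (\<Sum>K\<in>M. \<Sum>\<alpha>\<in>multi_indices m.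
     elem_integral K (\<lambda>x. (weak_deriv (elem K) \<alpha> g x)\<^sup>2))"

definition broken_L2_norm :: "'a::euclidean_space cell set \<Rightarrow> ('a \<Rightarrow> real) \<Rightarrow> real" where
  "broken_L2_norm M g = sqrt (\<Sum>K\<in>M. elem_integral K (\<lambda>x. (g x)\<^sup>2))"

definition quad_sum :: "('a cell \<Rightarrow> 'j set) \<Rightarrow> ('a cell \<Rightarrow> 'j \<Rightarrow> 'a) \<Rightarrow> ('a cell \<Rightarrow> 'j \<Rightarrow> real) \<Rightarrow>
    'a::euclidean_space cell \<Rightarrow> ('a \<Rightarrow> real) \<Rightarrow> real" where
  "quad_sum J xs \<omega> K g = (\<Sum>j\<in>J K. \<omega> K j * g (xs K j))"

definition quadrature_rule :: "nat \<Rightarrow> real \<Rightarrow> 'a::euclidean_space cell set \<Rightarrow>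
    ('a cell \<Rightarrow> 'j set) \<Rightarrow> ('a cell \<Rightarrow> 'j \<Rightarrow> 'a) \<Rightarrow> ('a cell \<Rightarrow> 'j \<Rightarrow> real) \<Rightarrow> bool" where
  "quadrature_rule q C M J xs \<omega> \<longleftrightarrow>
     (\<forall>K\<in>M. finite (J K) \<and> (\<forall>j\<in>J K. xs K j \<in> elem K \<and> \<omega> K j > 0)) \<and>
     (\<forall>K\<in>M. \<forall>\<phi>\<in>tensor_poly q.
        quad_sum J xs \<omega> K (\<lambda>x. (\<phi> x)\<^sup>2) = elem_integral K (\<lambda>x. (\<phi> x)\<^sup>2)) \<and>
     (\<forall>\<phi>\<in>Vh q M. \<forall>g\<in>broken_sobolev (q + 1) M.
        (\<Sum>K\<in>M. \<bar>quad_sum J xs \<omega> K (\<lambda>x. \<phi> x * g x) - elem_integral K (\<lambda>x. \<phi> x * g x)\<bar>)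
        \<le> C * mesh_size M ^ (q + 1) * broken_L2_norm M \<phi> * broken_seminorm (q + 1) M g)"

definition f_quot :: "(real \<Rightarrow> real) \<Rightarrow> real \<Rightarrow> real" where
  "f_quot f z = (if z = 0 then Lim (at 0) (\<lambda>s. f s / s) else f z / z)"

definition dg_solution :: "'a::euclidean_space set \<Rightarrow> 'a cell set \<Rightarrow> nat \<Rightarrow> flux_params \<Rightarrow>
    ('a cell \<Rightarrow> 'j set) \<Rightarrow> ('a cell \<Rightarrow> 'j \<Rightarrow> 'a) \<Rightarrow> ('a cell \<Rightarrow> 'j \<Rightarrow> real) \<Rightarrow>
    (real \<Rightarrow> real) \<Rightarrow> real \<Rightarrow> (real \<Rightarrow> 'a \<Rightarrow> real) \<Rightarrow> (real \<Rightarrow> 'a \<Rightarrow> real) \<Rightarrow> (real \<Rightarrow> 'a \<Rightarrow> real) \<Rightarrow> bool"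
  where
  "dg_solution \<Omega> M q P J xs \<omega> f \<mu> u v w \<longleftrightarrow>
     (\<forall>K\<in>M. \<forall>\<phi>u\<in>Vh q M. \<forall>\<phi>v\<in>Vh q M. \<forall>\<phi>w\<in>Vh q M. \<forall>t\<ge>0.
        elem_integral K (\<lambda>x. \<phi>u x * (dt u t x - v t x))
          + quad_sum J xs \<omega> K (\<lambda>x. f_quot f (u t x) * \<phi>u x * (dt u t x - v t x)) = 0 \<and>
        elem_integral K (\<lambda>x. dt w t x * \<phi>w x) + B1 \<Omega> M P (v t) (w t) K \<phi>w = 0 \<and>
        elem_integral K (\<lambda>x. dt v t x * \<phi>v x + u t x * \<phi>v x + \<mu> * v t x * \<phi>v x)
          + quad_sum J xs \<omega> K (\<lambda>x. \<phi>v x * f (u t x)) + B2 \<Omega> M P (v t) (w t) K \<phi>v = 0)"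

definition energy :: "'a::euclidean_space cell set \<Rightarrow>
    ('a cell \<Rightarrow> 'j set) \<Rightarrow> ('a cell \<Rightarrow> 'j \<Rightarrow> 'a) \<Rightarrow> ('a cell \<Rightarrow> 'j \<Rightarrow> real) \<Rightarrow> (real \<Rightarrow> real) \<Rightarrow>
    (real \<Rightarrow> 'a \<Rightarrow> real) \<Rightarrow> (real \<Rightarrow> 'a \<Rightarrow> real) \<Rightarrow> (real \<Rightarrow> 'a \<Rightarrow> real) \<Rightarrow> real \<Rightarrow> real" where
  "energy M J xs \<omega> F u v w t =
     (\<Sum>K\<in>M. elem_integral K (\<lambda>x. 1/2 * (v t x)\<^sup>2 + 1/2 * (w t x)\<^sup>2 + 1/2 * (u t x)\<^sup>2)
            + quad_sum J xs \<omega> K (\<lambda>x. F (u t x)))"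

end

theory Submission
  imports Defs
begin

text \<open>Testing the scheme with \<open>(u, v, w)\<close> itself gives \<open>dE/dt\<close> as the damping term minus
  \<open>\<Sum>K. B1(v, w) + B2(w, v)\<close>; the nonlinear terms cancel because of the quotient \<open>f(u)/u\<close> in the first
  equation. Green's formula on each element turns \<open>B1 + B2\<close> into integrals over its faces. Every face
  either lies on the physical boundary or is shared by exactly two elements. On the former, the flux
  density is the stated quadratic form in \<open>\<zeta>\<^sub>1, \<zeta>\<^sub>2\<close>, because \<open>\<gamma>\<^sub>i \<kappa>\<^sub>i = 0\<close> and \<open>\<gamma>\<^sub>i\<^sup>2 + \<kappa>\<^sub>i\<^sup>2 = 1\<close>; on the
  latter, \<open>\<lbrakk>a b\<rbrakk> = \<lbrakk>a\<rbrakk> {b}\<^sub>\<alpha> + \<lbrakk>b\<rbrakk> {a}\<^bsub>1-\<alpha>\<^esub>\<close> cancels everything but the penalty terms.\<close>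

subsection \<open>Green's formula on an element\<close>

text \<open>Members of \<open>Vh\<close> are prescribed only on the open elements, and a Bochner
  integral splits over a sum only when the terms are integrable. Hence every integrand that has to
  be split or differentiated is matched, on the element or face in question, with a globally defined
  polynomial. The other obstacle is geometric: the physical boundary is defined topologically,
  through \<open>frontier \<Omega>\<close>, on a domain that need not be a box, so the existence of
  a neighbour across any other face has to be derived from the grid.\<close>

lemma pd_eq:
  assumes "(p has_derivative p') (at x)"
  shows "pd i p x = p' i"
  using frechet_derivative_at[OF assms] by (simp add: pd_def)

lemma real_polynomial_function_has_derivative:
  assumes "real_polynomial_function p"
  shows "(p has_derivative frechet_derivative p (at x)) (at x)"
  using assms differentiable_at_real_polynomial_function frechet_derivative_works by blast

text \<open>This class, unlike \<open>tensor_poly q\<close>, is closed under products as well as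
  derivatives, so continuity and differentiability of all derived expressions follow from their
  shape.\<close>

lemma real_polynomial_function_pd:
  assumes "real_polynomial_function p"
  shows "real_polynomial_function (pd i p)"
  using assms
proof induction
  case (linear f)
  have "pd i f = (\<lambda>x. f i)"
    using pd_eq[OF bounded_linear_imp_has_derivative[OF linear]] by blast
  then show ?case by auto
next
  case (const c)
  have "pd i (\<lambda>x. c) = (\<lambda>x. 0)"
    using pd_eq[OF has_derivative_const] by blast
  then show ?case by auto
next
  case (add f g)
  have "pd i (\<lambda>x. f x + g x) = (\<lambda>x. pd i f x + pd i g x)"
    using pd_eq[OF has_derivative_add[OF add(1,2)[THEN real_polynomial_function_has_derivative]]]
    by (auto simp: pd_def)
  with add.IH show ?case by auto
next
  case (mult f g)
  have "pd i (\<lambda>x. f x * g x) = (\<lambda>x. f x * pd i g x + pd i f x * g x)"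
    using pd_eq[OF has_derivative_mult[OF mult(1,2)[THEN real_polynomial_function_has_derivative]]]
    by (auto simp: pd_def)
  with mult show ?case by auto
qed

text \<open>The first-order cross terms \<open>pd i q x * pd i p x\<close> cancel. Summed over
  \<open>i\<close>, this makes the integrand of Green's second identity a divergence.\<close>

lemma pd_mult_diff:
  assumes "real_polynomial_function p" "real_polynomial_function q"
  shows "pd i (\<lambda>x. q x * pd i p x - p x * pd i q x) x = q x * pd i (pd i p) x - p x * pd i (pd i q) x"
proof -
  note d = real_polynomial_function_has_derivative
  have "((\<lambda>x. q x * pd i p x - p x * pd i q x) has_derivative
     (\<lambda>h. (q x * frechet_derivative (pd i p) (at x) h + frechet_derivative q (at x) h * pd i p x) -
       (p x * frechet_derivative (pd i q) (at x) h + frechet_derivative p (at x) h * pd i q x))) (at x)"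
    by (intro has_derivative_diff has_derivative_mult d assms real_polynomial_function_pd)
  from pd_eq[OF this, of i] show ?thesis
    by (simp add: pd_def algebra_simps)
qed

text \<open>Restricts \<open>p\<close> to a line parallel to \<open>i\<close>, where the
  one-dimensional fundamental theorem of calculus will be applied.\<close>

lemma has_real_derivative_pd:
  assumes "p differentiable at (z + y *\<^sub>R i)"
  shows "((\<lambda>y. p (z + y *\<^sub>R i)) has_real_derivative pd i p (z + y *\<^sub>R i)) (at y)"
proof -
  have "(p has_derivative frechet_derivative p (at (z + y *\<^sub>R i))) (at (z + y *\<^sub>R i))"
    using assms frechet_derivative_works by blast
  then have "((\<lambda>y. p (z + y *\<^sub>R i)) has_derivative
      (\<lambda>h. frechet_derivative p (at (z + y *\<^sub>R i)) (h *\<^sub>R i))) (at y)"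
    by (rule has_derivative_compose[rotated]) (auto intro!: derivative_eq_intros)
  moreover have "frechet_derivative p (at (z + y *\<^sub>R i)) (h *\<^sub>R i) = h * pd i p (z + y *\<^sub>R i)" for h
    using linear_frechet_derivative[OF assms] by (simp add: pd_def linear_scale)
  ultimately have "((\<lambda>y. p (z + y *\<^sub>R i)) has_derivative (\<lambda>h. h * pd i p (z + y *\<^sub>R i))) (at y)"
    by simp
  then show ?thesis
    unfolding has_field_derivative_def by (rule has_derivative_eq_rhs) (simp add: fun_eq_iff)
qed

lemma continuous_on_real_polynomial_function:
  assumes "real_polynomial_function p"
  shows "continuous_on A p"
  using assms continuous_real_polymonial_function continuous_at_imp_continuous_on by blast

lemma real_polynomial_function_tensor_poly:
  assumes "p \<in> tensor_poly q"
  shows "real_polynomial_function p"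
proof -
  obtain c where "p = (\<lambda>x. \<Sum>\<alpha>\<in>Basis \<rightarrow>\<^sub>E {..q}. c \<alpha> * (\<Prod>i\<in>Basis. (x \<bullet> i) ^ \<alpha> i))"
    using assms by (auto simp: tensor_poly_def)
  then show ?thesis
    by (simp only:) (intro real_polynomial_function_sum real_polynomial_function.intros
      real_polynomial_function_prod real_polynomial_function_power
      bounded_linear_inner_left finite_PiE finite_Basis finite_atMost)
qed

lemma tensor_poly_add:
  assumes "p \<in> tensor_poly q" "r \<in> tensor_poly q"
  shows "(\<lambda>x. p x + r x) \<in> tensor_poly q"
proof -
  obtain c d where "\<And>x. p x = (\<Sum>\<alpha>\<in>Basis \<rightarrow>\<^sub>E {..q}. c \<alpha> * (\<Prod>i\<in>Basis. (x \<bullet> i) ^ \<alpha> i))"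
     "\<And>x. r x = (\<Sum>\<alpha>\<in>Basis \<rightarrow>\<^sub>E {..q}. d \<alpha> * (\<Prod>i\<in>Basis. (x \<bullet> i) ^ \<alpha> i))"
    using assms by (auto simp: tensor_poly_def)
  then show ?thesis
    by (auto simp: tensor_poly_def sum.distrib algebra_simps intro!: exI[of _ "\<lambda>\<alpha>. c \<alpha> + d \<alpha>"])
qed

section \<open>Integrals over elements and faces, and the divergence theorem\<close>

lemma elem_integral_eq_cbox:
  assumes "continuous_on UNIV (g :: 'a::euclidean_space \<Rightarrow> real)"
  shows "elem_integral K g = (LINT x:cbox (fst K) (snd K)|lborel. g x)"
  unfolding elem_integral_def elem_def
proof (rule set_integral_cong_set)
  have [measurable]: "g \<in> borel_measurable borel"
    using assms by (rule borel_measurable_continuous_onI)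
  show "set_borel_measurable lborel (cbox (fst K) (snd K)) g"
    "set_borel_measurable lborel (box (fst K) (snd K)) g"
    by (simp_all add: set_borel_measurable_def)
  show "AE x in lborel. x \<in> cbox (fst K) (snd K) \<longleftrightarrow> x \<in> box (fst K) (snd K)"
    using AE_not_in[OF null_sets_cbox_Diff_box[of "fst K" "snd K"]] box_subset_cbox
    by (auto elim!: eventually_mono)
qed

lemma set_integrable_elem:
  assumes "continuous_on UNIV (g :: 'a::euclidean_space \<Rightarrow> real)"
  shows "set_integrable lborel (elem K) g"
proof -
  have "set_integrable lborel (cbox (fst K) (snd K)) g"
    using borel_integrable_compact[of "cbox (fst K) (snd K)" g] continuous_on_subset[OF assms]
    by (auto simp: set_integrable_def)
  then show ?thesis
    by (rule set_integrable_subset) (auto simp: elem_def box_subset_cbox)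
qed

lemma elem_integral_cong:
  assumes "\<And>x. x \<in> elem K \<Longrightarrow> g x = h x"
  shows "elem_integral K g = elem_integral K h"
  unfolding elem_integral_def using assms by (intro set_lebesgue_integral_cong) (auto simp: elem_def)

lemma elem_integral_add:
  assumes "continuous_on UNIV g" "continuous_on UNIV h"
  shows "elem_integral K (\<lambda>x. g x + h x) = elem_integral K g + elem_integral K h"
  unfolding elem_integral_def
  by (intro set_integral_add set_integrable_elem assms)

lemma elem_integral_cmult: "elem_integral K (\<lambda>x. c * g x) = c * elem_integral K g"
  by (simp add: elem_integral_def)

lemma elem_integral_sum:
  assumes "\<And>i. i \<in> I \<Longrightarrow> continuous_on UNIV (g i)"
  shows "elem_integral K (\<lambda>x. \<Sum>i\<in>I. g i x) = (\<Sum>i\<in>I. elem_integral K (g i))"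
  using assms
  by (induction I rule: infinite_finite_induct)
     (simp_all add: elem_integral_add continuous_on_sum, simp_all add: elem_integral_def)

lemma inner_sum_Basis_diff:
  fixes i k :: "'a::euclidean_space"
  assumes "i \<in> Basis" "k \<in> Basis"
  shows "(c *\<^sub>R i + (\<Sum>j\<in>Basis - {i}. y j *\<^sub>R j)) \<bullet> k = (if k = i then c else y k)"
proof -
  have "(\<Sum>j\<in>Basis - {i}. y j * (j \<bullet> k)) = (\<Sum>j\<in>Basis - {i}. if j = k then y k else 0)"
    using assms by (intro sum.cong) (auto simp: inner_Basis)
  with assms show ?thesis
    by (auto simp: inner_add_left inner_sum_left inner_Basis)
qed

lemma hyperplane_embedding_measurable [measurable]:
  "(\<lambda>y. c *\<^sub>R i + (\<Sum>j\<in>Basis - {i}. y j *\<^sub>R j)) \<in>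
     measurable (\<Pi>\<^sub>M j\<in>Basis - {i::'a::euclidean_space}. lborel) borel"
  by measurable

lemma closed_face: "closed (face K i s)"
proof -
  have "face K i s = cbox (fst K) (snd K) \<inter> {x. i \<bullet> x = face_level K i s}"
    by (auto simp: face_def inner_commute)
  then show ?thesis by (simp only:) (intro closed_Int closed_cbox closed_hyperplane)
qed

text \<open>The surface measure of a hyperplane is infinite from dimension two on, so a bound on
  \<open>g\<close> is not enough. The pullback is supported in the product of intervals
  \<open>?A\<close>, which has finite measure.\<close>

lemma set_integrable_face:
  fixes g :: "'a::euclidean_space \<Rightarrow> real"
  assumes "i \<in> Basis" "continuous_on UNIV g"
  shows "set_integrable (hyperplane_measure i (face_level K i s)) (face K i s) g"
proof -
  interpret product_sigma_finite "\<lambda>_::'a. lborel :: real measure" ..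
  let ?c = "face_level K i s"
  let ?T = "\<lambda>y. ?c *\<^sub>R i + (\<Sum>j\<in>Basis - {i}. y j *\<^sub>R j)"
  let ?A = "\<Pi>\<^sub>E j\<in>Basis - {i}. {fst K \<bullet> j..snd K \<bullet> j}"
  have [measurable]: "g \<in> borel_measurable borel"
    using assms(2) by (rule borel_measurable_continuous_onI)
  have [measurable]: "face K i s \<in> sets borel"
    by (intro borel_closed closed_face)
  have "compact (g ` cbox (fst K) (snd K))"
    using compact_continuous_image[OF continuous_on_subset[OF assms(2)]] compact_cbox by blast
  then obtain B where B: "\<And>x. x \<in> cbox (fst K) (snd K) \<Longrightarrow> norm (g x) \<le> B"
    using compact_imp_bounded[THEN bounded_iff[THEN iffD1]] by (metis imageI)
  have "integrable (\<Pi>\<^sub>M j\<in>Basis - {i}. lborel) (\<lambda>y. indicator (face K i s) (?T y) *\<^sub>R g (?T y))"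
  proof (rule integrableI_bounded_set)
    show "?A \<in> sets (\<Pi>\<^sub>M j\<in>Basis - {i}. lborel)"
      by (rule sets_PiM_I_finite) auto
    show "emeasure (\<Pi>\<^sub>M j\<in>Basis - {i}. lborel) ?A < \<infinity>"
      by (subst emeasure_PiM) (auto simp: ennreal_prod_eq_top less_top[symmetric] emeasure_lborel_Icc_eq)
    show "AE y in \<Pi>\<^sub>M j\<in>Basis - {i}. lborel. y \<in> ?A \<longrightarrow>
        norm (indicator (face K i s) (?T y) *\<^sub>R g (?T y)) \<le> max 0 B"
      using B by (auto simp: face_def split: split_indicator simp: le_max_iff_disj)
    show "AE y in \<Pi>\<^sub>M j\<in>Basis - {i}. lborel. y \<notin> ?A \<longrightarrow>
        indicator (face K i s) (?T y) *\<^sub>R g (?T y) = 0"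
    proof (intro AE_I2 impI)
      fix y assume y: "y \<in> space (\<Pi>\<^sub>M j\<in>Basis - {i}. lborel)" "y \<notin> ?A"
      \<comment> \<open>Membership in \<open>?A\<close> also demands extensionality, supplied by
        \<open>y\<close> lying in the space of the product measure.\<close>
      have "y \<in> ?A" if "?T y \<in> face K i s"
        using that y(1) assms(1)
        by (auto simp: face_def mem_box inner_sum_Basis_diff space_PiM PiE_iff)
      with y(2) show "indicator (face K i s) (?T y) *\<^sub>R g (?T y) = 0"
        by (auto split: split_indicator)
    qed
  qed measurable
  then show ?thesis
    by (simp add: set_integrable_def hyperplane_measure_def integrable_distr_eq)
qed

lemma face_integral_cong:
  assumes "\<And>x. x \<in> face K i s \<Longrightarrow> g x = h x"
  shows "face_integral K i s g = face_integral K i s h"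
  unfolding face_integral_def set_lebesgue_integral_def using assms
  by (intro Bochner_Integration.integral_cong) (auto split: split_indicator)

lemma face_integral_add:
  assumes "i \<in> Basis" "continuous_on UNIV g" "continuous_on UNIV h"
  shows "face_integral K i s (\<lambda>x. g x + h x) = face_integral K i s g + face_integral K i s h"
  unfolding face_integral_def by (intro set_integral_add set_integrable_face assms)

lemma face_integral_cmult: "face_integral K i s (\<lambda>x. c * g x) = c * face_integral K i s g"
  by (simp add: face_integral_def)

text \<open>A non-integrable \<open>g\<close> has integral 0 by convention, so the sign survives in
  that case too.\<close>

lemma face_integral_nonneg:
  assumes "\<And>x. 0 \<le> g x"
  shows "0 \<le> face_integral K i s g"
  unfolding face_integral_def set_lebesgue_integral_def
  using assms by (intro Bochner_Integration.integral_nonneg) simp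

text \<open>Opposite faces carry different hyperplane measures. Pulling both back to one product
  measure, with one indicator, makes their difference a single integral.\<close>

lemma face_integral_eq_PiM:
  fixes g :: "'a::euclidean_space \<Rightarrow> real"
  assumes "i \<in> Basis" "fst K \<bullet> i \<le> snd K \<bullet> i" "continuous_on UNIV g"
  shows "face_integral K i s g = (LINT y|(\<Pi>\<^sub>M j\<in>Basis - {i}. lborel).
     indicator {y. \<forall>j\<in>Basis - {i}. fst K \<bullet> j \<le> y j \<and> y j \<le> snd K \<bullet> j} y
       * g (face_level K i s *\<^sub>R i + (\<Sum>j\<in>Basis - {i}. y j *\<^sub>R j)))"
proof -
  have [measurable]: "g \<in> borel_measurable borel"
    using assms(3) by (rule borel_measurable_continuous_onI)
  have [measurable]: "face K i s \<in> sets borel"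
    by (intro borel_closed closed_face)
  have "face_level K i s *\<^sub>R i + (\<Sum>j\<in>Basis - {i}. y j *\<^sub>R j) \<in> face K i s \<longleftrightarrow>
     (\<forall>j\<in>Basis - {i}. fst K \<bullet> j \<le> y j \<and> y j \<le> snd K \<bullet> j)" for y
    using assms(1,2) by (auto simp: face_def mem_box inner_sum_Basis_diff face_level_def)
  then show ?thesis
    unfolding face_integral_def set_lebesgue_integral_def hyperplane_measure_def
    by (subst integral_distr) (auto intro!: Bochner_Integration.integral_cong split: split_indicator)
qed

text \<open>Divergence theorem for a field parallel to \<open>i\<close>: Fubini separates coordinate
  \<open>i\<close> from the others, and the fundamental theorem of calculus integrates along each
  line.\<close>

lemma elem_integral_pd:
  fixes p :: "'a::euclidean_space \<Rightarrow> real"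
  assumes i: "i \<in> Basis" and K: "fst K \<bullet> i \<le> snd K \<bullet> i"
    and p: "\<And>x. p differentiable at x" and cont: "continuous_on UNIV (pd i p)"
  shows "elem_integral K (pd i p) = face_integral K i 1 p - face_integral K i (-1) p"
proof -
  interpret product_sigma_finite "\<lambda>_::'a. lborel :: real measure" ..
  let ?N = "\<Pi>\<^sub>M j\<in>Basis - {i}. lborel :: real measure"
  let ?S = "{y. \<forall>j\<in>Basis - {i}. fst K \<bullet> j \<le> y j \<and> y j \<le> snd K \<bullet> j}"
  let ?z = "\<lambda>y. \<Sum>j\<in>Basis - {i}. y j *\<^sub>R j"
  let ?g = "\<lambda>x. indicator (cbox (fst K) (snd K)) x *\<^sub>R pd i p x"
  let ?e = "\<lambda>f. \<Sum>b\<in>Basis. f b *\<^sub>R (b::'a)"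
  have contp: "continuous_on UNIV p"
    using p by (simp add: continuous_at_imp_continuous_on differentiable_imp_continuous_within)
  have [measurable]: "pd i p \<in> borel_measurable borel" "p \<in> borel_measurable borel"
    using cont contp by (auto intro: borel_measurable_continuous_onI)
  have B: "insert i (Basis - {i}) = Basis" using i by auto
  have e_upd: "?e (y(i := r)) = ?z y + r *\<^sub>R i" for y r
    using i by (subst sum.remove[OF finite_Basis i]) (auto simp: add.commute intro!: sum.cong)
  have in_cbox: "?z y + r *\<^sub>R i \<in> cbox (fst K) (snd K) \<longleftrightarrow> y \<in> ?S \<and> r \<in> {fst K \<bullet> i..snd K \<bullet> i}" for y r
    using i inner_sum_Basis_diff[OF i, of _ r y] by (auto simp: mem_box add.commute)
  have [measurable]: "?e \<in> measurable (\<Pi>\<^sub>M b\<in>Basis. lborel) borel"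
    by measurable
  have "integrable lborel ?g"
    using borel_integrable_compact[of "cbox (fst K) (snd K)" "pd i p"] continuous_on_subset[OF cont] by auto
  then have int: "integrable (\<Pi>\<^sub>M b\<in>Basis. lborel) (\<lambda>f. ?g (?e f))"
    by (subst (asm) lborel_eq, subst (asm) integrable_distr_eq) auto
  have inner: "(\<integral>r. ?g (?e (y(i := r))) \<partial>lborel)
      = indicator ?S y * (p (?z y + (snd K \<bullet> i) *\<^sub>R i) - p (?z y + (fst K \<bullet> i) *\<^sub>R i))" for y
  proof -
    have "(\<integral>r. ?g (?e (y(i := r))) \<partial>lborel)
        = (\<integral>r. indicator ?S y * (pd i p (?z y + r *\<^sub>R i) * indicator {fst K \<bullet> i..snd K \<bullet> i} r) \<partial>lborel)"
      by (intro Bochner_Integration.integral_cong refl, simp only: e_upd)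
         (auto simp del: atLeastAtMost_iff simp: in_cbox split: split_indicator)
    also have "\<dots> = indicator ?S y * (\<integral>r. pd i p (?z y + r *\<^sub>R i) * indicator {fst K \<bullet> i..snd K \<bullet> i} r \<partial>lborel)"
      by simp
    also have "(\<integral>r. pd i p (?z y + r *\<^sub>R i) * indicator {fst K \<bullet> i..snd K \<bullet> i} r \<partial>lborel)
        = p (?z y + (snd K \<bullet> i) *\<^sub>R i) - p (?z y + (fst K \<bullet> i) *\<^sub>R i)"
    proof (rule integral_FTC_Icc_real[OF K])
      show "DERIV (\<lambda>r. p (?z y + r *\<^sub>R i)) r :> pd i p (?z y + r *\<^sub>R i)" for r
        by (rule has_real_derivative_pd) (rule p)
      have "continuous_on UNIV (\<lambda>r. pd i p (?z y + r *\<^sub>R i))"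
        by (rule continuous_on_compose2[OF cont]) (auto intro!: continuous_intros)
      then show "isCont (\<lambda>r. pd i p (?z y + r *\<^sub>R i)) r" for r
        by (simp add: continuous_on_eq_continuous_at)
    qed
    finally show ?thesis .
  qed
  have face_int: "integrable ?N (\<lambda>y. indicator ?S y * p (face_level K i s *\<^sub>R i + ?z y))" for s
  proof -
    have [measurable]: "face K i s \<in> sets borel"
      by (intro borel_closed closed_face)
    have "integrable ?N (\<lambda>y. indicator (face K i s) (face_level K i s *\<^sub>R i + ?z y)
        *\<^sub>R p (face_level K i s *\<^sub>R i + ?z y))"
      using set_integrable_face[OF i contp, of K s]
      unfolding set_integrable_def hyperplane_measure_def
      by (subst (asm) integrable_distr_eq) auto
    moreover have "face_level K i s *\<^sub>R i + ?z y \<in> face K i s \<longleftrightarrow> y \<in> ?S" for y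
      using i K by (auto simp: face_def mem_box inner_sum_Basis_diff face_level_def)
    ultimately show ?thesis
      by (simp add: indicator_def)
  qed
  have "elem_integral K (pd i p) = (\<integral>x. ?g x \<partial>lborel)"
    by (simp add: elem_integral_eq_cbox[OF cont] set_lebesgue_integral_def)
  \<comment> \<open>\<open>lborel\<close> is the image of a product of one-dimensional Lebesgue
    measures, which lets \<open>product_integral_insert\<close> single out coordinate
    \<open>i\<close>.\<close>
  also have "\<dots> = (\<integral>f. ?g (?e f) \<partial>(\<Pi>\<^sub>M b\<in>Basis. lborel))"
    by (subst lborel_eq, subst integral_distr) auto
  also have "\<dots> = (\<integral>y. (\<integral>r. ?g (?e (y(i := r))) \<partial>lborel) \<partial>?N)"
    using product_integral_insert[of "Basis - {i}" i "\<lambda>f. ?g (?e f)"] int by (simp only: B) simp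
  also have "\<dots> = (\<integral>y. indicator ?S y * p (face_level K i 1 *\<^sub>R i + ?z y)
      - indicator ?S y * p (face_level K i (-1) *\<^sub>R i + ?z y) \<partial>?N)"
    unfolding inner by (simp add: face_level_def algebra_simps)
  also have "\<dots> = (\<integral>y. indicator ?S y * p (face_level K i 1 *\<^sub>R i + ?z y) \<partial>?N)
      - (\<integral>y. indicator ?S y * p (face_level K i (-1) *\<^sub>R i + ?z y) \<partial>?N)"
    by (rule Bochner_Integration.integral_diff[OF face_int face_int])
  finally show ?thesis
    by (simp only: face_integral_eq_PiM[OF i K contp])
qed

lemma elem_integral_Green:
  fixes p q :: "'a::euclidean_space \<Rightarrow> real"
  assumes K: "\<And>i. i \<in> Basis \<Longrightarrow> fst K \<bullet> i \<le> snd K \<bullet> i"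
    and p: "real_polynomial_function p" and q: "real_polynomial_function q"
  shows "elem_integral K (\<lambda>x. q x * laplacian p x - p x * laplacian q x) =
    (\<Sum>i\<in>Basis. \<Sum>s\<in>{-1, 1}. face_integral K i s (\<lambda>x. q x * (s * pd i p x) - p x * (s * pd i q x)))"
proof -
  let ?g = "\<lambda>i x. q x * pd i p x - p x * pd i q x"
  have g: "real_polynomial_function (?g i)" for i
    by (intro real_polynomial_function_diff real_polynomial_function.intros(4) real_polynomial_function_pd p q)
  have "elem_integral K (\<lambda>x. q x * laplacian p x - p x * laplacian q x)
      = elem_integral K (\<lambda>x. \<Sum>i\<in>Basis. pd i (?g i) x)"
    by (simp add: pd_mult_diff[OF p q] laplacian_def sum_distrib_left sum_subtractf)
  also have "\<dots> = (\<Sum>i\<in>Basis. elem_integral K (pd i (?g i)))"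
    by (intro elem_integral_sum continuous_on_real_polynomial_function real_polynomial_function_pd g)
  also have "\<dots> = (\<Sum>i\<in>Basis. face_integral K i 1 (?g i) - face_integral K i (-1) (?g i))"
    by (intro sum.cong refl elem_integral_pd K differentiable_at_real_polynomial_function
      continuous_on_real_polynomial_function real_polynomial_function_pd g)
  \<comment> \<open>The factor \<open>s\<close> is the sign of the outward normal; it absorbs the
    minus sign of the lower face.\<close>
  also have "\<dots> = (\<Sum>i\<in>Basis. \<Sum>s\<in>{-1, 1}. face_integral K i s (\<lambda>x. s * ?g i x))"
    by (subst face_integral_cmult) simp
  finally show ?thesis
    by (simp add: algebra_simps)
qed

subsection \<open>Faces of a Cartesian mesh\<close>

lemma elem_nonempty_iff: "elem K \<noteq> {} \<longleftrightarrow> (\<forall>i\<in>Basis. fst K \<bullet> i < snd K \<bullet> i)"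
  by (simp add: elem_def box_ne_empty)

lemma closure_elem: "elem K \<noteq> {} \<Longrightarrow> closure (elem K) = cbox (fst K) (snd K)"
  by (simp add: elem_def closure_box)

lemma open_elem: "open (elem K)"
  by (simp add: elem_def open_box)

text \<open>Makes the filter in \<open>tr\<close> nontrivial, so that a limit, once found, is the
  value of \<open>Lim\<close>.\<close>

lemma islimpt_elem:
  assumes "elem K \<noteq> {}" "x \<in> cbox (fst K) (snd K)"
  shows "x islimpt elem K"
proof (cases "x \<in> elem K")
  case True
  then show ?thesis
    using open_elem interior_limit_point interior_open by metis
next
  case False
  then show ?thesis
    using assms closure_elem[OF assms(1)] by (auto simp: closure_def)
qed

text \<open>The trace sees \<open>g\<close> only inside the open element, so any extension
  continuous at \<open>x\<close> computes it.\<close>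

lemma tr_eq:
  fixes g :: "'a::euclidean_space \<Rightarrow> 'b::real_normed_vector"
  assumes "elem K \<noteq> {}" "x \<in> cbox (fst K) (snd K)" "\<And>y. y \<in> elem K \<Longrightarrow> g y = h y" "isCont h x"
  shows "tr K g x = h x"
  unfolding tr_def
proof (rule tendsto_Lim)
  show "\<not> trivial_limit (at x within elem K)"
    using islimpt_elem[OF assms(1,2)] by (simp add: trivial_limit_within)
  have "(h \<longlongrightarrow> h x) (at x within elem K)"
    using assms(4) by (simp add: continuous_at_imp_continuous_at_within flip: continuous_within)
  then show "(g \<longlongrightarrow> h x) (at x within elem K)"
    by (rule Lim_transform_eventually) (simp add: assms(3) eventually_at_filter)
qed

lemma face_subset_cbox: "face K i s \<subseteq> cbox (fst K) (snd K)"
  by (auto simp: face_def)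

text \<open>For the forward direction, test the inclusion of the faces on their lower and upper corners.\<close>

lemma face_eq_iff:
  fixes K K' :: "'a::euclidean_space cell"
  assumes "elem K \<noteq> {}" "elem K' \<noteq> {}" and i: "i \<in> Basis"
  shows "face K i s = face K' i s' \<longleftrightarrow> face_level K i s = face_level K' i s' \<and>
     (\<forall>j\<in>Basis - {i}. fst K \<bullet> j = fst K' \<bullet> j \<and> snd K \<bullet> j = snd K' \<bullet> j)"
proof
  have ne: "\<forall>i\<in>Basis. fst K \<bullet> i < snd K \<bullet> i" "\<forall>i\<in>Basis. fst K' \<bullet> i < snd K' \<bullet> i"
    using assms by (simp_all add: elem_nonempty_iff)
  have le: "face_level K i s = face_level K' i s' \<and>
      (\<forall>j\<in>Basis - {i}. fst K' \<bullet> j \<le> fst K \<bullet> j \<and> snd K \<bullet> j \<le> snd K' \<bullet> j)"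
    if sub: "face K i s \<subseteq> face K' i s'" and ne: "\<forall>i\<in>Basis. fst K \<bullet> i < snd K \<bullet> i"
    for K K' :: "'a cell" and s s'
  proof -
    define lo hi where "lo = fst K + (face_level K i s - fst K \<bullet> i) *\<^sub>R i"
      and "hi = snd K + (face_level K i s - snd K \<bullet> i) *\<^sub>R i"
    have "lo \<in> face K i s" "hi \<in> face K i s"
      using ne i by (auto simp: lo_def hi_def face_def mem_box inner_simps inner_Basis face_level_def less_imp_le)
    then have "lo \<in> face K' i s'" "hi \<in> face K' i s'"
      using sub by auto
    then show ?thesis
      using i by (auto simp: lo_def hi_def face_def mem_box inner_simps inner_Basis split: if_splits)
  qed
  {
    assume "face K i s = face K' i s'"
    then show "face_level K i s = face_level K' i s' \<and>
     (\<forall>j\<in>Basis - {i}. fst K \<bullet> j = fst K' \<bullet> j \<and> snd K \<bullet> j = snd K' \<bullet> j)"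
      using le[of K s K' s'] le[of K' s' K s] ne by (auto intro: antisym)
  next
    assume eq: "face_level K i s = face_level K' i s' \<and>
     (\<forall>j\<in>Basis - {i}. fst K \<bullet> j = fst K' \<bullet> j \<and> snd K \<bullet> j = snd K' \<bullet> j)"
    have "x \<in> face K i s \<longleftrightarrow> x \<bullet> i = face_level K i s \<and> (\<forall>j\<in>Basis - {i}. fst K \<bullet> j \<le> x \<bullet> j \<and> x \<bullet> j \<le> snd K \<bullet> j)"
      if "\<forall>i\<in>Basis. fst K \<bullet> i < snd K \<bullet> i" for x and K :: "'a cell" and s
      using that i by (auto simp: face_def mem_box face_level_def less_imp_le)
    from this[OF ne(1)] this[OF ne(2)] eq show "face K i s = face K' i s'"
      by (auto simp del: split_paired_All)
  }
qed

lemma grid_cellsD: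
  assumes "K \<in> grid_cells X" "i \<in> Basis"
  shows "fst K \<bullet> i \<in> X i" "snd K \<bullet> i \<in> X i" "fst K \<bullet> i < snd K \<bullet> i"
    "{fst K \<bullet> i<..<snd K \<bullet> i} \<inter> X i = {}"
  using assms by (cases K; simp add: grid_cells_def)+

text \<open>Equal faces have equal extent in all directions but \<open>i\<close>, and the same
  \<open>s\<close> picks out a shared breakpoint in direction \<open>i\<close>. As neither cell has
  a breakpoint strictly inside, the other end is shared too.\<close>

lemma grid_cells_face_unique:
  assumes "K \<in> grid_cells X" "K' \<in> grid_cells X" "i \<in> Basis" "face K i s = face K' i s"
  shows "K = K'"
proof -
  have ne: "elem K \<noteq> {}" "elem K' \<noteq> {}"
    using grid_cellsD(3)[OF assms(1)] grid_cellsD(3)[OF assms(2)] by (auto simp: elem_nonempty_iff)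
  note eq = face_eq_iff[OF ne assms(3), THEN iffD1, OF assms(4)]
  have "fst K \<bullet> i = fst K' \<bullet> i \<or> snd K \<bullet> i = snd K' \<bullet> i"
    using eq by (auto simp: face_level_def split: if_splits)
  then have "fst K \<bullet> i = fst K' \<bullet> i \<and> snd K \<bullet> i = snd K' \<bullet> i"
    using grid_cellsD[OF assms(1,3)] grid_cellsD[OF assms(2,3)]
    by (smt (verit) disjoint_iff greaterThanLessThan_iff)
  with eq have "\<forall>j\<in>Basis. fst K \<bullet> j = fst K' \<bullet> j \<and> snd K \<bullet> j = snd K' \<bullet> j"
    by blast
  then show ?thesis
    by (metis euclidean_eqI prod.expand)
qed

lemma cartesian_meshE:
  assumes "cartesian_mesh \<Omega> M"
  obtains X where "finite M" "\<And>i. i \<in> Basis \<Longrightarrow> finite (X i)" "M \<subseteq> grid_cells X"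
    "\<And>K. K \<in> M \<Longrightarrow> elem K \<noteq> {}" "\<Omega> = interior (\<Union>K\<in>M. cbox (fst K) (snd K))"
proof -
  obtain X where X: "finite M" "\<forall>i\<in>Basis. finite (X i)" "M \<subseteq> grid_cells X"
    "\<Omega> = interior (\<Union>K\<in>M. closure (elem K))"
    using assms by (auto simp: cartesian_mesh_def)
  moreover from X have ne: "elem K \<noteq> {}" if "K \<in> M" for K
    using that by (auto simp: grid_cells_def elem_nonempty_iff)
  ultimately show ?thesis
    by (intro that[of X]) (auto simp: closure_elem)
qed

lemma mesh_face_unique:
  assumes "cartesian_mesh \<Omega> M" "K \<in> M" "K' \<in> M" "i \<in> Basis" "face K i s = face K' i s"
  shows "K = K'"
  using assms grid_cells_face_unique by (metis cartesian_meshE subsetD)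

text \<open>One point of the face in the interior of \<open>\<Omega>\<close> suffices. The centre of
  the face works: the open box spanned by the two elements surrounds it and is covered by their
  closed boxes.\<close>

lemma interior_face_not_boundary:
  assumes M: "cartesian_mesh \<Omega> M" and "L \<in> M" "R \<in> M" and i: "i \<in> Basis"
    and eq: "face L i 1 = face R i (-1)"
  shows "\<not> face L i 1 \<subseteq> frontier \<Omega>"
proof -
  obtain X where X: "\<And>K. K \<in> M \<Longrightarrow> elem K \<noteq> {}" "\<Omega> = interior (\<Union>K\<in>M. cbox (fst K) (snd K))"
    using cartesian_meshE[OF M] by metis
  have ne: "\<And>j. j \<in> Basis \<Longrightarrow> fst L \<bullet> j < snd L \<bullet> j" "\<And>j. j \<in> Basis \<Longrightarrow> fst R \<bullet> j < snd R \<bullet> j"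
    using X(1) assms(2,3) by (auto simp: elem_nonempty_iff)
  have lev: "snd L \<bullet> i = fst R \<bullet> i" "\<And>j. j \<in> Basis \<Longrightarrow> j \<noteq> i \<Longrightarrow> fst L \<bullet> j = fst R \<bullet> j \<and> snd L \<bullet> j = snd R \<bullet> j"
    using face_eq_iff[OF X(1)[OF assms(2)] X(1)[OF assms(3)] i] eq by (auto simp: face_level_def)
  \<comment> \<open>The centre of \<open>L\<close>, moved in direction \<open>i\<close> onto its
    upper face.\<close>
  define m where "m = (1/2) *\<^sub>R (fst L + snd L) + ((snd L \<bullet> i - fst L \<bullet> i) / 2) *\<^sub>R i"
  have m: "m \<bullet> j = (if j = i then snd L \<bullet> i else (fst L \<bullet> j + snd L \<bullet> j) / 2)" if "j \<in> Basis" for j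
    using that i by (auto simp: m_def inner_simps inner_Basis field_simps)
  have "m \<in> face L i 1"
    using ne i by (fastforce simp: face_def mem_box m face_level_def less_imp_le)
  moreover have "m \<in> box (fst L) (snd R)"
    using ne lev i by (fastforce simp: mem_box m)
  moreover have "box (fst L) (snd R) \<subseteq> cbox (fst L) (snd L) \<union> cbox (fst R) (snd R)"
  proof
    fix x assume x: "x \<in> box (fst L) (snd R)"
    show "x \<in> cbox (fst L) (snd L) \<union> cbox (fst R) (snd R)"
    proof (cases "x \<bullet> i \<le> snd L \<bullet> i")
      case True
      then have "x \<in> cbox (fst L) (snd L)"
        using x lev by (fastforce simp: mem_box less_imp_le)
      then show ?thesis ..
    next
      case False
      then have "x \<in> cbox (fst R) (snd R)"
        using x lev by (fastforce simp: mem_box less_imp_le)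
      then show ?thesis ..
    qed
  qed
  then have "box (fst L) (snd R) \<subseteq> \<Omega>"
    using assms(2,3) unfolding X(2) by (intro interior_maximal) (auto simp: open_box)
  ultimately have "m \<in> face L i 1" "m \<in> interior \<Omega>"
    using X(2) by auto
  then show ?thesis
    by (auto simp: frontier_def)
qed

text \<open>If the face contained a point of the open set \<open>\<Omega>\<close>, then moving from that point towards the
  centre of the face and slightly across it would lead into an element of the mesh; since the grid
  has no breakpoints in between, this element is the neighbour.\<close>

lemma face_without_neighbour:
  assumes M: "cartesian_mesh \<Omega> M" and K: "K \<in> M" and i: "i \<in> Basis" and s: "s \<in> {-1, 1}"
    and no: "\<And>K'. K' \<in> M \<Longrightarrow> face K' i (- s) \<noteq> face K i s"
  shows "face K i s \<subseteq> frontier \<Omega>"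
proof
  fix x assume x: "x \<in> face K i s"
  obtain X where X: "\<And>i. i \<in> Basis \<Longrightarrow> finite (X i)" "M \<subseteq> grid_cells X"
    "\<And>K. K \<in> M \<Longrightarrow> elem K \<noteq> {}" and \<Omega>: "\<Omega> = interior (\<Union>K\<in>M. cbox (fst K) (snd K))"
    using cartesian_meshE[OF M] by metis
  have grid: "fst K \<bullet> j \<in> X j" "snd K \<bullet> j \<in> X j" "fst K \<bullet> j < snd K \<bullet> j"
    "{fst K \<bullet> j<..<snd K \<bullet> j} \<inter> X j = {}" if "K \<in> M" "j \<in> Basis" for K j
    using X(2) that grid_cellsD by blast+
  let ?c = "face_level K i s"
  have "elem K \<subseteq> \<Omega>"
    unfolding \<Omega> using K closure_elem[OF X(3)[OF K]] closure_subset[of "elem K"]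
    by (intro interior_maximal open_elem) auto
  then have "x \<in> closure \<Omega>"
    using x face_subset_cbox closure_mono closure_elem[OF X(3)[OF K]] by blast
  moreover have "x \<notin> \<Omega>"
  proof
    assume "x \<in> \<Omega>"
    then obtain \<epsilon> where \<epsilon>: "\<epsilon> > 0" "ball x \<epsilon> \<subseteq> \<Omega>"
      using \<Omega> open_interior open_contains_ball by metis
    \<comment> \<open>Every other breakpoint in direction \<open>i\<close> is at least
      \<open>\<delta>\<close> away from the level of the face, so a shorter step meets no further
      grid line.\<close>
    obtain \<delta> where \<delta>: "\<delta> > 0" "\<And>b. b \<in> X i \<Longrightarrow> b \<noteq> ?c \<Longrightarrow> \<delta> \<le> \<bar>b - ?c\<bar>"
      using finite_set_avoid[OF X(1)[OF i], of ?c] by (metis dist_real_def dist_commute)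
    \<comment> \<open>\<open>d\<close> points to the centre of the element; \<open>e\<close> keeps
      its components along the face and moves outward at unit speed. The tangential part is needed
      because \<open>x\<close> may lie on the rim of the face, where other cells meet it.\<close>
    define d where "d = (1/2) *\<^sub>R (fst K + snd K) - x"
    define e where "e = d + (s - d \<bullet> i) *\<^sub>R i"
    \<comment> \<open>The bound 1 keeps the tangential components convex combinations; the other two
      keep the point short of the next breakpoint and inside the ball. Adding 1 to the norm keeps
      the denominator positive.\<close>
    define t where "t = Min {1, \<delta> / 2, \<epsilon> / (2 * (norm e + 1))}"
    have t: "t > 0" "t \<le> 1" "t < \<delta>" "t * norm e < \<epsilon>"
    proof -
      have "0 < 2 * (norm e + 1)" by (simp add: add_nonneg_pos)
      then show t0: "t > 0" "t \<le> 1" "t < \<delta>" using \<epsilon>(1) \<delta>(1) by (auto simp: t_def min_less_iff_disj)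
      have "t \<le> \<epsilon> / (2 * (norm e + 1))" by (simp add: t_def)
      then have "t * (2 * (norm e + 1)) \<le> \<epsilon>" using \<open>0 < 2 * (norm e + 1)\<close> by (simp add: pos_le_divide_eq)
      then have "2 * (t * norm e) + 2 * t \<le> \<epsilon>" by (simp add: algebra_simps)
      then show "t * norm e < \<epsilon>" using t0 mult_nonneg_nonneg[of t "norm e"] norm_ge_zero[of e] by linarith
    qed
    have "x + t *\<^sub>R e \<in> ball x \<epsilon>"
      using t by (simp add: dist_norm)
    then have "x + t *\<^sub>R e \<in> (\<Union>K\<in>M. cbox (fst K) (snd K))"
      using \<epsilon>(2) \<Omega> interior_subset by blast
    then obtain K' where K': "K' \<in> M" and mem: "x + t *\<^sub>R e \<in> cbox (fst K') (snd K')"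
      by blast
    have xi: "(x + t *\<^sub>R e) \<bullet> i = ?c + t * s"
      using x i by (simp add: e_def inner_simps face_def)
    \<comment> \<open>\<open>?y\<close> lies strictly between consecutive breakpoints of
      \<open>K\<close> and in the closed interval of \<open>K'\<close>; since no breakpoint lies
      strictly inside either interval, the two coincide.\<close>
    have off: "fst K' \<bullet> j = fst K \<bullet> j \<and> snd K' \<bullet> j = snd K \<bullet> j" if j: "j \<in> Basis" "j \<noteq> i" for j
    proof -
      let ?a = "fst K \<bullet> j" and ?b = "snd K \<bullet> j" and ?y = "(x + t *\<^sub>R e) \<bullet> j"
      have "?y = (1 - t) * (x \<bullet> j) + t * ((?a + ?b) / 2)"
        using i j by (simp add: e_def d_def inner_simps inner_Basis algebra_simps)
      moreover have "?a \<le> x \<bullet> j" "x \<bullet> j \<le> ?b"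
        using x j by (auto simp: face_def mem_box)
      then have "(1 - t) * ?a \<le> (1 - t) * (x \<bullet> j)" "(1 - t) * (x \<bullet> j) \<le> (1 - t) * ?b"
        using t by (auto intro: mult_left_mono)
      moreover have "t * ?a < t * ((?a + ?b) / 2)" "t * ((?a + ?b) / 2) < t * ?b"
        using t grid(3)[OF K j(1)] by auto
      ultimately have "?a < ?y" "?y < ?b"
        by (simp_all add: algebra_simps)
      moreover have "fst K' \<bullet> j \<le> ?y" "?y \<le> snd K' \<bullet> j"
        using mem j by (auto simp: mem_box)
      ultimately show ?thesis
        using grid[OF K j(1)] grid[OF K' j(1)] by (smt (verit) disjoint_iff greaterThanLessThan_iff)
    qed
    have bounds: "fst K' \<bullet> i \<le> ?c + t * s" "?c + t * s \<le> snd K' \<bullet> i"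
      using mem i by (auto simp: mem_box simp flip: xi)
    have "?c \<in> X i"
      using grid[OF K i] by (auto simp: face_level_def)
    then have cK': "?c \<notin> {fst K' \<bullet> i<..<snd K' \<bullet> i}"
      using grid(4)[OF K' i] by blast
    have "face_level K' i (- s) = ?c"
    proof (cases "s = 1")
      \<comment> \<open>The lower end of \<open>K'\<close> is a breakpoint at most
        \<open>?c + t\<close>, hence at most \<open>?c\<close>, while its upper end exceeds
        \<open>?c\<close>. As \<open>?c\<close> is not strictly inside, it is the lower end.\<close>
      case True
      then have "fst K' \<bullet> i \<le> ?c"
        using \<delta>(2)[OF grid(1)[OF K' i]] bounds t by (cases "fst K' \<bullet> i = ?c") auto
      with True cK' bounds t show ?thesis
        by (auto simp: face_level_def)
    next
      case False
      then have s1: "s = -1" using s by auto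
      then have "?c \<le> snd K' \<bullet> i"
        using \<delta>(2)[OF grid(2)[OF K' i]] bounds t by (cases "snd K' \<bullet> i = ?c") auto
      with s1 cK' bounds t show ?thesis
        by (auto simp: face_level_def)
    qed
    then have "face K' i (- s) = face K i s"
      using off face_eq_iff[OF X(3)[OF K'] X(3)[OF K] i] by auto
    with no K' show False by blast
  qed
  ultimately show "x \<in> frontier \<Omega>"
    using \<Omega> by (simp add: frontier_def)
qed

text \<open>Trades the topological definition of the physical boundary for a combinatorial one. For
  \<open>s = -1\<close> the neighbour is the left element, hence the two uses of
  \<open>interior_face_not_boundary\<close> with swapped roles.\<close>

lemma boundary_faces_iff:
  assumes M: "cartesian_mesh \<Omega> M" and K: "K \<in> M" and i: "i \<in> Basis" and s: "s \<in> {-1, 1}"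
  shows "(K, i, s) \<in> boundary_faces \<Omega> M \<longleftrightarrow> (\<forall>K'\<in>M. face K' i (- s) \<noteq> face K i s)"
proof
  assume "(K, i, s) \<in> boundary_faces \<Omega> M"
  then have bd: "face K i s \<subseteq> frontier \<Omega>"
    by (simp add: boundary_faces_def)
  show "\<forall>K'\<in>M. face K' i (- s) \<noteq> face K i s"
  proof (intro ballI notI)
    fix K' assume "K' \<in> M" "face K' i (- s) = face K i s"
    then show False
      using s bd interior_face_not_boundary[OF M K \<open>K' \<in> M\<close> i]
        interior_face_not_boundary[OF M \<open>K' \<in> M\<close> K i] by auto
  qed
next
  assume "\<forall>K'\<in>M. face K' i (- s) \<noteq> face K i s"
  then show "(K, i, s) \<in> boundary_faces \<Omega> M"
    using face_without_neighbour[OF M K i s] K i s by (simp add: boundary_faces_def)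
qed

lemma neighbour_eq:
  assumes "cartesian_mesh \<Omega> M" "K' \<in> M" "i \<in> Basis" "face K' i (- s) = face K i s"
  shows "neighbour M K i s = K'"
  unfolding neighbour_def using assms(2,4) mesh_face_unique[OF assms(1) _ assms(2,3)]
  by (intro the_equality) (simp, metis)

text \<open>A side off the physical boundary is the upper side of \<open>L\<close> or the lower side
  of \<open>R\<close> for a unique interior face \<open>(L, R, i)\<close>, and the sign tells the
  two cases apart.\<close>

lemma sum_faces:
  fixes G :: "'a::euclidean_space cell \<Rightarrow> 'a \<Rightarrow> real \<Rightarrow> real"
  assumes M: "cartesian_mesh \<Omega> M"
  shows "(\<Sum>K\<in>M. \<Sum>i\<in>Basis. \<Sum>s\<in>{-1, 1}. G K i s) =
     (\<Sum>(L, R, i)\<in>interior_faces M. G L i 1 + G R i (-1)) + (\<Sum>(K, i, s)\<in>boundary_faces \<Omega> M. G K i s)"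
proof -
  let ?T = "M \<times> Basis \<times> {-1, 1::real}"
  let ?I = "interior_faces M" and ?B = "boundary_faces \<Omega> M"
  let ?l = "\<lambda>(L, R, i). (L, i, 1::real)" and ?r = "\<lambda>(L, R, i). (R, i, -1::real)"
  let ?G = "\<lambda>(K, i, s). G K i s"
  have fin: "finite M"
    using cartesian_meshE[OF M] by metis
  have finI: "finite ?I"
    by (rule finite_subset[of _ "M \<times> M \<times> Basis"]) (auto simp: interior_faces_def fin)
  have BT: "?B \<subseteq> ?T"
    by (auto simp: boundary_faces_def)
  have diff: "?T - ?B = ?l ` ?I \<union> ?r ` ?I"
  proof (intro equalityI subsetI)
    fix k assume k: "k \<in> ?T - ?B"
    obtain K i s where [simp]: "k = (K, i, s)" by (cases k)
    have "K \<in> M" "i \<in> Basis" "s \<in> {-1, 1}" "(K, i, s) \<notin> ?B"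
      using k by auto
    then obtain K' where "K' \<in> M" "face K' i (- s) = face K i s"
      using boundary_faces_iff[OF M, of K i s] by blast
    then have "s = 1 \<and> (K, K', i) \<in> ?I \<or> s = -1 \<and> (K', K, i) \<in> ?I"
      using k by (auto simp: interior_faces_def)
    then show "k \<in> ?l ` ?I \<union> ?r ` ?I"
      by (force simp: image_iff)
  next
    fix k assume "k \<in> ?l ` ?I \<union> ?r ` ?I"
    then obtain L R i where "(L, R, i) \<in> ?I" "k = (L, i, 1) \<or> k = (R, i, -1)"
      by auto
    then show "k \<in> ?T - ?B"
      using boundary_faces_iff[OF M, of L i 1] boundary_faces_iff[OF M, of R i "-1"]
      by (auto simp: interior_faces_def)
  qed
  \<comment> \<open>Either element together with \<open>i\<close> determines the other, because an
    oriented face belongs to one element only.\<close>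
  have inj: "inj_on ?l ?I" "inj_on ?r ?I"
    by (simp_all add: inj_on_def interior_faces_def) (metis mesh_face_unique[OF M] prod.inject)+
  have "(\<Sum>K\<in>M. \<Sum>i\<in>Basis. \<Sum>s\<in>{-1, 1}. G K i s) = sum ?G ?T"
    by (simp only: sum.cartesian_product)
  also have "\<dots> = sum ?G (?T - ?B) + sum ?G ?B"
    using fin BT by (intro sum.subset_diff) auto
  also have "sum ?G (?T - ?B) = sum ?G (?l ` ?I) + sum ?G (?r ` ?I)"
    unfolding diff using finI by (intro sum.union_disjoint) auto
  also have "\<dots> = (\<Sum>(L, R, i)\<in>?I. G L i 1 + G R i (-1))"
    by (simp only: sum.reindex[OF inj(1)] sum.reindex[OF inj(2)]) (simp add: case_prod_beta sum.distrib o_def)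
  finally show ?thesis .
qed

subsection \<open>Piecewise polynomials and energy fluxes\<close>

text \<open>Members of \<open>Vh\<close> are polynomial on one element, traces and fluxes on one
  face, each with its own witness. Hiding the witness lets integrals be split by checking the shape
  of the terms.\<close>

definition poly_on :: "'a::real_normed_vector set \<Rightarrow> ('a \<Rightarrow> real) \<Rightarrow> bool" where
  "poly_on S g \<longleftrightarrow> (\<exists>p. real_polynomial_function p \<and> (\<forall>x\<in>S. g x = p x))"

lemma poly_on_subset: "poly_on T g \<Longrightarrow> S \<subseteq> T \<Longrightarrow> poly_on S g"
  unfolding poly_on_def by blast

lemma poly_on_const: "poly_on S (\<lambda>x. c)"
  by (auto simp: poly_on_def)

lemma poly_on_add:
  assumes "poly_on S g" "poly_on S h"
  shows "poly_on S (\<lambda>x. g x + h x)"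
proof -
  obtain p q where "real_polynomial_function p" "real_polynomial_function q"
      "\<forall>x\<in>S. g x = p x" "\<forall>x\<in>S. h x = q x"
    using assms by (auto simp: poly_on_def)
  then show ?thesis
    unfolding poly_on_def by (intro exI[of _ "\<lambda>x. p x + q x"]) auto
qed

lemma poly_on_mult:
  assumes "poly_on S g" "poly_on S h"
  shows "poly_on S (\<lambda>x. g x * h x)"
proof -
  obtain p q where "real_polynomial_function p" "real_polynomial_function q"
      "\<forall>x\<in>S. g x = p x" "\<forall>x\<in>S. h x = q x"
    using assms by (auto simp: poly_on_def)
  then show ?thesis
    unfolding poly_on_def by (intro exI[of _ "\<lambda>x. p x * q x"]) auto
qed

lemma poly_on_minus: "poly_on S g \<Longrightarrow> poly_on S (\<lambda>x. - g x)"
  using poly_on_mult[OF poly_on_const[of S "-1"]] by force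

lemma poly_on_diff: "poly_on S g \<Longrightarrow> poly_on S h \<Longrightarrow> poly_on S (\<lambda>x. g x - h x)"
  using poly_on_add[OF _ poly_on_minus] by force

lemmas poly_on_intros = poly_on_const poly_on_add poly_on_mult poly_on_minus poly_on_diff

lemma poly_on_Vh: "v \<in> Vh q M \<Longrightarrow> K \<in> M \<Longrightarrow> poly_on (elem K) v"
  unfolding Vh_def poly_on_def using real_polynomial_function_tensor_poly by blast

lemma poly_on_elem_integral_add:
  assumes "poly_on (elem K) g" "poly_on (elem K) h"
  shows "elem_integral K (\<lambda>x. g x + h x) = elem_integral K g + elem_integral K h"
proof -
  obtain p q where pq: "real_polynomial_function p" "real_polynomial_function q"
      "\<And>x. x \<in> elem K \<Longrightarrow> g x = p x" "\<And>x. x \<in> elem K \<Longrightarrow> h x = q x"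
    using assms by (auto simp: poly_on_def)
  have "elem_integral K (\<lambda>x. g x + h x) = elem_integral K (\<lambda>x. p x + q x)"
    "elem_integral K g = elem_integral K p" "elem_integral K h = elem_integral K q"
    using pq by (auto intro!: elem_integral_cong)
  then show ?thesis
    using elem_integral_add pq(1,2) continuous_on_real_polynomial_function by metis
qed

lemma poly_on_elem_integral_diff:
  assumes "poly_on (elem K) g" "poly_on (elem K) h"
  shows "elem_integral K (\<lambda>x. g x - h x) = elem_integral K g - elem_integral K h"
  using poly_on_elem_integral_add[OF assms(1) poly_on_mult[OF poly_on_const[of _ "-1"] assms(2)]]
    elem_integral_cmult[of K "-1" h] by simp

lemma poly_on_face_integral_add:
  assumes "i \<in> Basis" "poly_on (face K i s) g" "poly_on (face K i s) h"
  shows "face_integral K i s (\<lambda>x. g x + h x) = face_integral K i s g + face_integral K i s h"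
proof -
  obtain p q where pq: "real_polynomial_function p" "real_polynomial_function q"
      "\<And>x. x \<in> face K i s \<Longrightarrow> g x = p x" "\<And>x. x \<in> face K i s \<Longrightarrow> h x = q x"
    using assms by (auto simp: poly_on_def)
  have "face_integral K i s (\<lambda>x. g x + h x) = face_integral K i s (\<lambda>x. p x + q x)"
    "face_integral K i s g = face_integral K i s p" "face_integral K i s h = face_integral K i s q"
    using pq by (auto intro!: face_integral_cong)
  then show ?thesis
    using face_integral_add[OF assms(1)] pq(1,2) continuous_on_real_polynomial_function by metis
qed

lemma poly_on_face_integral_diff:
  assumes "i \<in> Basis" "poly_on (face K i s) g" "poly_on (face K i s) h"
  shows "face_integral K i s (\<lambda>x. g x - h x) = face_integral K i s g - face_integral K i s h"
  using poly_on_face_integral_add[OF assms(1,2) poly_on_mult[OF poly_on_const[of _ "-1"] assms(3)]]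
    face_integral_cmult[of K i s "-1" h] by simp

section \<open>Derivatives and traces of piecewise polynomials\<close>

lemma pd_cong_elem:
  assumes "real_polynomial_function p" "\<And>y. y \<in> elem K \<Longrightarrow> g y = p y" "x \<in> elem K"
  shows "pd i g x = pd i p x"
proof -
  have "(g has_derivative frechet_derivative p (at x)) (at x)"
    using has_derivative_transform_within_open[OF real_polynomial_function_has_derivative[OF assms(1)]
        open_elem assms(3)] assms(2) by simp
  from pd_eq[OF this] show ?thesis
    by (simp add: pd_def)
qed

text \<open>Second derivatives at \<open>x\<close> see first derivatives nearby, so
  \<open>pd_cong_elem\<close> is used twice: on the whole open element for the inner derivative,
  then at \<open>x\<close>.\<close>

lemma laplacian_cong_elem:
  assumes "real_polynomial_function p" "\<And>y. y \<in> elem K \<Longrightarrow> g y = p y" "x \<in> elem K"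
  shows "laplacian g x = laplacian p x"
  unfolding laplacian_def
  by (intro sum.cong refl pd_cong_elem[OF real_polynomial_function_pd[OF assms(1)] _ assms(3)]
      pd_cong_elem[OF assms(1,2)])

lemma poly_on_laplacian:
  assumes "poly_on (elem K) g"
  shows "poly_on (elem K) (laplacian g)"
proof -
  obtain p where p: "real_polynomial_function p" "\<And>x. x \<in> elem K \<Longrightarrow> g x = p x"
    using assms by (auto simp: poly_on_def)
  have "real_polynomial_function (laplacian p)"
    unfolding laplacian_def[abs_def]
    by (intro real_polynomial_function_sum finite_Basis real_polynomial_function_pd p)
  then show ?thesis
    using laplacian_cong_elem[OF p] by (auto simp: poly_on_def)
qed

lemma tr_poly:
  assumes "elem K \<noteq> {}" "real_polynomial_function p" "\<And>y. y \<in> elem K \<Longrightarrow> g y = p y"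
    and "x \<in> cbox (fst K) (snd K)"
  shows "tr K g x = p x"
  using assms by (intro tr_eq continuous_real_polymonial_function) auto

lemma inner_grad: "i \<in> Basis \<Longrightarrow> grad p x \<bullet> i = pd i p x"
  by (simp add: grad_def inner_sum_left inner_Basis if_distrib cong: if_cong)

lemma tr_grad_poly:
  assumes "elem K \<noteq> {}" "real_polynomial_function p" "\<And>y. y \<in> elem K \<Longrightarrow> g y = p y"
    and "x \<in> cbox (fst K) (snd K)"
  shows "tr K (grad g) x = grad p x"
proof (rule tr_eq[OF assms(1,4)])
  show "grad g y = grad p y" if "y \<in> elem K" for y
    unfolding grad_def using pd_cong_elem[OF assms(2,3) that] by simp
  show "isCont (grad p) x"
    unfolding grad_def[abs_def]
    by (intro continuous_intros continuous_real_polymonial_function real_polynomial_function_pd assms(2))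
qed

lemma nderiv_eq: "nderiv K i s g x = s * (tr K (grad g) x \<bullet> i)"
  by (simp add: nderiv_def)

lemma poly_on_tr:
  assumes "elem K \<noteq> {}" "poly_on (elem K) g"
  shows "poly_on (cbox (fst K) (snd K)) (tr K g)"
  using assms tr_poly[OF assms(1)] unfolding poly_on_def by metis

lemma poly_on_tr_grad:
  assumes "elem K \<noteq> {}" "poly_on (elem K) g" "i \<in> Basis"
  shows "poly_on (cbox (fst K) (snd K)) (\<lambda>x. tr K (grad g) x \<bullet> i)"
  using assms tr_grad_poly[OF assms(1)] inner_grad[OF assms(3)] real_polynomial_function_pd
  unfolding poly_on_def by metis

section \<open>Fluxes through the faces at a fixed time\<close>

context
  fixes \<Omega> :: "'a::euclidean_space set" and M :: "'a cell set" and q :: nat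
    and v w :: "'a \<Rightarrow> real" and P :: flux_params
  assumes M: "cartesian_mesh \<Omega> M" and v: "v \<in> Vh q M" and w: "w \<in> Vh q M"
begin

lemma mesh_elem_nonempty: "K \<in> M \<Longrightarrow> elem K \<noteq> {}"
  using cartesian_meshE[OF M] by metis

lemma left_right_elem:
  assumes "K \<in> M" "i \<in> Basis" "s \<in> {-1, 1}" "(K, i, s) \<notin> boundary_faces \<Omega> M"
  shows "left_elem M K i s \<in> M \<and> right_elem M K i s \<in> M \<and>
    face K i s \<subseteq> cbox (fst (left_elem M K i s)) (snd (left_elem M K i s)) \<and>
    face K i s \<subseteq> cbox (fst (right_elem M K i s)) (snd (right_elem M K i s))"
proof -
  obtain K' where "K' \<in> M" "face K' i (- s) = face K i s"
    using boundary_faces_iff[OF M assms(1-3)] assms(4) by blast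
  moreover from this have "neighbour M K i s = K'"
    using neighbour_eq[OF M _ assms(2)] by blast
  ultimately show ?thesis
    using assms(1) face_subset_cbox[of K i s] face_subset_cbox[of K' i "-s"]
    by (auto simp: left_elem_def right_elem_def)
qed

lemma poly_on_face_tr:
  assumes "g \<in> Vh q M" "K \<in> M" "S \<subseteq> cbox (fst K) (snd K)" "i \<in> Basis"
  shows "poly_on S (tr K g)" "poly_on S (\<lambda>x. tr K (grad g) x \<bullet> i)"
  using poly_on_tr poly_on_tr_grad assms mesh_elem_nonempty poly_on_Vh poly_on_subset by metis+

lemma poly_on_fluxes:
  assumes K: "K \<in> M" and i: "i \<in> Basis" and s: "s \<in> {-1, 1}"
  shows "poly_on (face K i s) (v_star \<Omega> M P v w K i s)"
    "poly_on (face K i s) (w_star \<Omega> M P v w K i s)"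
    "poly_on (face K i s) (grad_v_star_n \<Omega> M P v w K i s)"
    "poly_on (face K i s) (grad_w_star_n \<Omega> M P v w K i s)"
proof -
  note tr = poly_on_face_tr[OF v _ _ i] poly_on_face_tr[OF w _ _ i]
  show "poly_on (face K i s) (v_star \<Omega> M P v w K i s)"
    "poly_on (face K i s) (w_star \<Omega> M P v w K i s)"
    "poly_on (face K i s) (grad_v_star_n \<Omega> M P v w K i s)"
    "poly_on (face K i s) (grad_w_star_n \<Omega> M P v w K i s)"
    using K face_subset_cbox left_right_elem[OF K i s] i
    unfolding v_star_def[abs_def] w_star_def[abs_def] grad_v_star_n_def[abs_def] grad_w_star_n_def[abs_def]
    by (cases "(K, i, s) \<in> boundary_faces \<Omega> M";
        simp add: zeta1_def zeta2_def nderiv_eq Let_def avg_def vjump_def jump_def inner_simps;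
        intro poly_on_intros tr; blast)+
qed

text \<open>The net rate at which energy leaves the element \<open>K\<close> through its face \<open>(K, i, s)\<close>.\<close>

definition energy_flux :: "'a cell \<Rightarrow> 'a \<Rightarrow> real \<Rightarrow> 'a \<Rightarrow> real" where
  "energy_flux K i s x =
     tr K w x * (nderiv K i s v x - grad_v_star_n \<Omega> M P v w K i s x)
     - tr K v x * (nderiv K i s w x - grad_w_star_n \<Omega> M P v w K i s x)
     + nderiv K i s w x * v_star \<Omega> M P v w K i s x
     - nderiv K i s v x * w_star \<Omega> M P v w K i s x"

lemma poly_on_face_trace:
  assumes "g \<in> Vh q M" "K \<in> M" "i \<in> Basis"
  shows "poly_on (face K i s) (tr K g)" "poly_on (face K i s) (nderiv K i s g)"
  using poly_on_face_tr[OF assms(1,2) face_subset_cbox assms(3)]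
  by (auto simp: nderiv_eq[abs_def] intro!: poly_on_intros)

lemma poly_on_energy_flux:
  assumes K: "K \<in> M" and i: "i \<in> Basis" and s: "s \<in> {-1, 1}"
  shows "poly_on (face K i s) (energy_flux K i s)"
  unfolding energy_flux_def[abs_def]
  by (intro poly_on_intros poly_on_face_trace[OF v K i] poly_on_face_trace[OF w K i] poly_on_fluxes assms)

lemma B1_plus_B2:
  assumes K: "K \<in> M"
  shows "B1 \<Omega> M P v w K w + B2 \<Omega> M P v w K v =
    (\<Sum>i\<in>Basis. \<Sum>s\<in>{-1, 1}. face_integral K i s (energy_flux K i s))"
proof -
  note ne = mesh_elem_nonempty[OF K]
  obtain pv where pv: "real_polynomial_function pv" "\<And>x. x \<in> elem K \<Longrightarrow> v x = pv x"
    using poly_on_Vh[OF v K] by (auto simp: poly_on_def)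
  obtain pw where pw: "real_polynomial_function pw" "\<And>x. x \<in> elem K \<Longrightarrow> w x = pw x"
    using poly_on_Vh[OF w K] by (auto simp: poly_on_def)
  \<comment> \<open>\<open>?fl1\<close> and \<open>?fl2\<close> are the boundary integrands of
    \<open>B1\<close> and \<open>B2\<close>; \<open>?gr\<close> is the one left by Green's formula.
    The combination \<open>?gr - ?fl1 - ?fl2\<close> is \<open>energy_flux\<close>.\<close>
  let ?fl1 = "\<lambda>i s x. tr K w x * grad_v_star_n \<Omega> M P v w K i s x - nderiv K i s w x * v_star \<Omega> M P v w K i s x"
  let ?fl2 = "\<lambda>i s x. nderiv K i s v x * w_star \<Omega> M P v w K i s x - tr K v x * grad_w_star_n \<Omega> M P v w K i s x"
  let ?gr = "\<lambda>i s x. tr K w x * nderiv K i s v x - tr K v x * nderiv K i s w x"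
  have "elem_integral K (\<lambda>x. - v x * laplacian w x) + elem_integral K (\<lambda>x. w x * laplacian v x)
      = elem_integral K (\<lambda>x. w x * laplacian v x - v x * laplacian w x)"
    by (subst poly_on_elem_integral_add[symmetric])
       (auto intro!: poly_on_intros poly_on_laplacian poly_on_Vh[OF v K] poly_on_Vh[OF w K])
  also have "\<dots> = elem_integral K (\<lambda>x. pw x * laplacian pv x - pv x * laplacian pw x)"
    using pv pw by (intro elem_integral_cong) (simp add: laplacian_cong_elem[OF pv] laplacian_cong_elem[OF pw])
  also have "\<dots> = (\<Sum>i\<in>Basis. \<Sum>s\<in>{-1, 1}.
      face_integral K i s (\<lambda>x. pw x * (s * pd i pv x) - pv x * (s * pd i pw x)))"
    using ne by (intro elem_integral_Green pv pw) (auto simp: elem_nonempty_iff less_imp_le)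
  also have "\<dots> = (\<Sum>i\<in>Basis. \<Sum>s\<in>{-1, 1}. face_integral K i s (?gr i s))"
  proof (intro sum.cong refl face_integral_cong)
    fix i s x assume i: "i \<in> (Basis :: 'a set)" and "x \<in> face K i s"
    then have "x \<in> cbox (fst K) (snd K)" using face_subset_cbox by blast
    then show "pw x * (s * pd i pv x) - pv x * (s * pd i pw x) = ?gr i s x"
      using i by (simp add: nderiv_eq tr_poly[OF ne pv] tr_poly[OF ne pw]
        tr_grad_poly[OF ne pv] tr_grad_poly[OF ne pw] inner_grad)
  qed
  finally have "B1 \<Omega> M P v w K w + B2 \<Omega> M P v w K v =
      (\<Sum>i\<in>Basis. \<Sum>s\<in>{-1, 1}. face_integral K i s (?gr i s)
        - face_integral K i s (?fl1 i s) - face_integral K i s (?fl2 i s))"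
    unfolding B1_def B2_def sum_subtractf by linarith
  also have "\<dots> = (\<Sum>i\<in>Basis. \<Sum>s\<in>{-1, 1}. face_integral K i s (energy_flux K i s))"
  proof (intro sum.cong refl)
    fix i s assume i: "i \<in> (Basis :: 'a set)" and s: "s \<in> {-1, 1 :: real}"
    note poly = poly_on_intros poly_on_face_trace[OF v K i] poly_on_face_trace[OF w K i] poly_on_fluxes[OF K i s]
    have "face_integral K i s (?gr i s) - face_integral K i s (?fl1 i s) - face_integral K i s (?fl2 i s)
        = face_integral K i s (\<lambda>x. ?gr i s x - ?fl1 i s x - ?fl2 i s x)"
    proof -
      have gr: "poly_on (face K i s) (?gr i s)" and fl: "poly_on (face K i s) (?fl1 i s)" "poly_on (face K i s) (?fl2 i s)"
        by (intro poly)+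
      show ?thesis
        by (simp only: poly_on_face_integral_diff[OF i gr fl(1)]
            poly_on_face_integral_diff[OF i poly_on_diff[OF gr fl(1)] fl(2)])
    qed
    also have "(\<lambda>x. ?gr i s x - ?fl1 i s x - ?fl2 i s x) = energy_flux K i s"
      by (simp add: energy_flux_def fun_eq_iff algebra_simps)
    finally show "face_integral K i s (?gr i s) - face_integral K i s (?fl1 i s) - face_integral K i s (?fl2 i s)
        = face_integral K i s (energy_flux K i s)" .
  qed
  finally show ?thesis .
qed

text \<open>Write \<open>vn\<close>, \<open>wn\<close> for the normal derivatives. Without the zeta
  corrections the fluxes contribute \<open>v * wn - w * vn\<close>. The corrections free of
  \<open>\<nu>\<^sub>1\<close>, \<open>\<nu>\<^sub>2\<close> cancel this, since
  \<open>(\<gamma>\<^sub>1 * w + \<kappa>\<^sub>1 * vn) * zeta1 = w * vn\<close> and similarly for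
  \<open>zeta2\<close>. The others give the squares, since \<open>(\<kappa>\<^sub>1 * w -
  \<gamma>\<^sub>1 * vn) * zeta1 = (\<kappa>\<^sub>1\<^sup>2 - \<gamma>\<^sub>1\<^sup>2) *
  zeta1\<^sup>2\<close>.\<close>

lemma energy_flux_boundary:
  assumes params: "(\<gamma>\<^sub>1 P, \<gamma>\<^sub>2 P, \<kappa>\<^sub>1 P, \<kappa>\<^sub>2 P) \<in> {(0, 1, 1, 0), (1, 1, 0, 0), (0, 0, 1, 1), (1, 0, 0, 1)}"
    and "(K, i, s) \<in> boundary_faces \<Omega> M"
  shows "energy_flux K i s = (\<lambda>x.
     \<nu>\<^sub>1 P * ((\<kappa>\<^sub>1 P)\<^sup>2 - (\<gamma>\<^sub>1 P)\<^sup>2) * (zeta1 P K i s v w x)\<^sup>2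
     + \<nu>\<^sub>2 P * ((\<gamma>\<^sub>2 P)\<^sup>2 - (\<kappa>\<^sub>2 P)\<^sup>2) * (zeta2 P K i s v w x)\<^sup>2)"
  using assms
  by (auto simp: fun_eq_iff energy_flux_def v_star_def w_star_def grad_v_star_n_def grad_w_star_n_def
      zeta1_def zeta2_def algebra_simps power2_eq_square)

text \<open>The jump identity is used twice, pairing \<open>v\<close> with \<open>grad w\<close>
  under \<open>\<alpha>\<^sub>1\<close> and \<open>w\<close> with \<open>grad v\<close> under
  \<open>\<alpha>\<^sub>2\<close>. Each penalty term is multiplied by the two one-sided values of
  the very jump it contains, and becomes a square.\<close>

lemma energy_flux_interior:
  assumes LR: "(L, R, i) \<in> interior_faces M"
  shows "energy_flux L i 1 x + energy_flux R i (-1) x =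
     \<tau>\<^sub>1 P * (norm (jump L R i v x))\<^sup>2 + \<beta>\<^sub>1 P * (vjump L R i (grad w) x)\<^sup>2
     + \<beta>\<^sub>2 P * (norm (jump L R i w x))\<^sup>2 + \<tau>\<^sub>2 P * (vjump L R i (grad v) x)\<^sup>2"
proof -
  have LR': "L \<in> M" "R \<in> M" and i: "i \<in> Basis" and eq: "face L i 1 = face R i (-1)"
    using LR by (auto simp: interior_faces_def)
  have nb: "(L, i, 1) \<notin> boundary_faces \<Omega> M" "(R, i, -1) \<notin> boundary_faces \<Omega> M"
    using boundary_faces_iff[OF M LR'(1) i, of 1] boundary_faces_iff[OF M LR'(2) i, of "-1"] LR' eq by auto
  have neigh: "neighbour M L i 1 = R" "neighbour M R i (-1) = L"
    using neighbour_eq[OF M LR'(2) i, of 1 L] neighbour_eq[OF M LR'(1) i, of "-1" R] eq by auto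
  have elems: "left_elem M L i 1 = L" "right_elem M L i 1 = R"
     "left_elem M R i (-1) = L" "right_elem M R i (-1) = R"
    by (simp_all add: left_elem_def right_elem_def neigh)
  have jump: "(norm (jump L R i g x))\<^sup>2 = (tr L g x - tr R g x)\<^sup>2" for g
  proof -
    have "jump L R i g x = (tr L g x - tr R g x) *\<^sub>R i"
      by (simp add: jump_def algebra_simps)
    then show ?thesis using i by simp
  qed
  show ?thesis
    unfolding jump using nb i
    by (simp add: energy_flux_def v_star_def w_star_def grad_v_star_n_def grad_w_star_n_def elems Let_def
        nderiv_eq vjump_def jump_def avg_def inner_simps)
       (simp add: algebra_simps power2_eq_square)
qed

lemma sum_B1_plus_B2:
  assumes params: "(\<gamma>\<^sub>1 P, \<gamma>\<^sub>2 P, \<kappa>\<^sub>1 P, \<kappa>\<^sub>2 P) \<in> {(0, 1, 1, 0), (1, 1, 0, 0), (0, 0, 1, 1), (1, 0, 0, 1)}"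
  shows "(\<Sum>K\<in>M. B1 \<Omega> M P v w K w + B2 \<Omega> M P v w K v) =
    (\<Sum>(L, R, i)\<in>interior_faces M. face_integral L i 1
         (\<lambda>x. \<tau>\<^sub>1 P * (norm (jump L R i v x))\<^sup>2 + \<beta>\<^sub>1 P * (vjump L R i (grad w) x)\<^sup>2
            + \<beta>\<^sub>2 P * (norm (jump L R i w x))\<^sup>2 + \<tau>\<^sub>2 P * (vjump L R i (grad v) x)\<^sup>2))
    + (\<Sum>(K, i, s)\<in>boundary_faces \<Omega> M. face_integral K i s
         (\<lambda>x. \<nu>\<^sub>1 P * ((\<kappa>\<^sub>1 P)\<^sup>2 - (\<gamma>\<^sub>1 P)\<^sup>2) * (zeta1 P K i s v w x)\<^sup>2
            + \<nu>\<^sub>2 P * ((\<gamma>\<^sub>2 P)\<^sup>2 - (\<kappa>\<^sub>2 P)\<^sup>2) * (zeta2 P K i s v w x)\<^sup>2))"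
proof -
  have "(\<Sum>K\<in>M. B1 \<Omega> M P v w K w + B2 \<Omega> M P v w K v) =
    (\<Sum>(L, R, i)\<in>interior_faces M. face_integral L i 1 (energy_flux L i 1) + face_integral R i (-1) (energy_flux R i (-1)))
    + (\<Sum>(K, i, s)\<in>boundary_faces \<Omega> M. face_integral K i s (energy_flux K i s))"
    by (simp only: B1_plus_B2 sum_faces[OF M] cong: sum.cong)
  also have "(\<Sum>(L, R, i)\<in>interior_faces M. face_integral L i 1 (energy_flux L i 1) + face_integral R i (-1) (energy_flux R i (-1)))
    = (\<Sum>(L, R, i)\<in>interior_faces M. face_integral L i 1 (\<lambda>x. energy_flux L i 1 x + energy_flux R i (-1) x))"
  proof (intro sum.cong refl)
    fix k assume "k \<in> interior_faces M"
    then obtain L R i where k [simp]: "k = (L, R, i)" and mem: "L \<in> M" "R \<in> M" and i: "i \<in> Basis"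
      and eq: "face L i 1 = face R i (-1)"
      by (auto simp: interior_faces_def)
    \<comment> \<open>\<open>face_integral\<close> depends on its element also through the level of
      the hyperplane; equal faces have equal levels, so the integral from \<open>R\<close> becomes
      one over the face of \<open>L\<close>.\<close>
    have "face_level L i 1 = face_level R i (-1)"
      using face_eq_iff[OF mesh_elem_nonempty[OF mem(1)] mesh_elem_nonempty[OF mem(2)] i] eq by blast
    then have "face_integral R i (-1) (energy_flux R i (-1)) = face_integral L i 1 (energy_flux R i (-1))"
      by (simp only: face_integral_def eq)
    moreover have "poly_on (face L i 1) (energy_flux L i 1)" "poly_on (face L i 1) (energy_flux R i (-1))"
      using poly_on_energy_flux[OF mem(1) i, of 1] poly_on_energy_flux[OF mem(2) i, of "-1"] eq by simp_all
    ultimately show "(case k of (L, R, i) \<Rightarrow>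
          face_integral L i 1 (energy_flux L i 1) + face_integral R i (-1) (energy_flux R i (-1)))
        = (case k of (L, R, i) \<Rightarrow> face_integral L i 1 (\<lambda>x. energy_flux L i 1 x + energy_flux R i (-1) x))"
      using poly_on_face_integral_add[OF i] by simp
  qed
  finally show ?thesis
    using energy_flux_interior energy_flux_boundary[OF params]
    by (simp add: case_prod_beta cong: sum.cong)
qed

end

subsection \<open>Energy balance\<close>

lemma C1_curve_has_derivative:
  assumes "C1_curve q M u" "K \<in> M" "x \<in> elem K" "t \<ge> 0"
  shows "((\<lambda>s. u s x) has_real_derivative dt u t x) (at t within {0..})"
  using assms vector_derivative_works
  unfolding C1_curve_def dt_def has_real_derivative_iff_has_vector_derivative by blast

text \<open>Polarization of exactness on squares, applied to \<open>p\<close>, \<open>r\<close> and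
  \<open>p + r\<close>. The nodes lie in the open elements, so polynomial representatives can
  replace \<open>g\<close> and \<open>h\<close> on both sides.\<close>

lemma quad_sum_mult:
  assumes "quadrature_rule q C M J xs \<omega>" "K \<in> M" "g \<in> Vh q M" "h \<in> Vh q M"
  shows "quad_sum J xs \<omega> K (\<lambda>x. g x * h x) = elem_integral K (\<lambda>x. g x * h x)"
proof -
  obtain p where p: "p \<in> tensor_poly q" "\<And>x. x \<in> elem K \<Longrightarrow> g x = p x"
    using assms by (auto simp: Vh_def)
  obtain r where r: "r \<in> tensor_poly q" "\<And>x. x \<in> elem K \<Longrightarrow> h x = r x"
    using assms by (auto simp: Vh_def)
  have square: "quad_sum J xs \<omega> K (\<lambda>x. (\<phi> x)\<^sup>2) = elem_integral K (\<lambda>x. (\<phi> x)\<^sup>2)"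
    if "\<phi> \<in> tensor_poly q" for \<phi>
    using assms that by (simp add: quadrature_rule_def)
  have node: "xs K j \<in> elem K" if "j \<in> J K" for j
    using assms that by (simp add: quadrature_rule_def)
  have poly: "poly_on (elem K) p" "poly_on (elem K) r"
    using real_polynomial_function_tensor_poly p(1) r(1) unfolding poly_on_def by blast+
  have expand: "(\<lambda>x. (p x + r x)\<^sup>2) = (\<lambda>x. ((p x)\<^sup>2 + (r x)\<^sup>2) + 2 * (p x * r x))"
    by (simp add: fun_eq_iff power2_sum)
  have "elem_integral K (\<lambda>x. (p x + r x)\<^sup>2)
      = elem_integral K (\<lambda>x. (p x)\<^sup>2) + elem_integral K (\<lambda>x. (r x)\<^sup>2) + 2 * elem_integral K (\<lambda>x. p x * r x)"
    unfolding expand unfolding elem_integral_cmult[symmetric] power2_eq_square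
    by (simp only: poly_on_elem_integral_add poly_on_intros poly)
  moreover have "quad_sum J xs \<omega> K (\<lambda>x. (p x + r x)\<^sup>2)
      = quad_sum J xs \<omega> K (\<lambda>x. (p x)\<^sup>2) + quad_sum J xs \<omega> K (\<lambda>x. (r x)\<^sup>2) + 2 * quad_sum J xs \<omega> K (\<lambda>x. p x * r x)"
    unfolding expand quad_sum_def by (simp add: sum.distrib sum_distrib_left algebra_simps)
  ultimately have "quad_sum J xs \<omega> K (\<lambda>x. p x * r x) = elem_integral K (\<lambda>x. p x * r x)"
    using square[OF p(1)] square[OF r(1)] square[OF tensor_poly_add[OF p(1) r(1)]] by simp
  moreover have "quad_sum J xs \<omega> K (\<lambda>x. g x * h x) = quad_sum J xs \<omega> K (\<lambda>x. p x * r x)"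
    unfolding quad_sum_def using node p r by (intro sum.cong) auto
  moreover have "elem_integral K (\<lambda>x. g x * h x) = elem_integral K (\<lambda>x. p x * r x)"
    using p r by (intro elem_integral_cong) simp
  ultimately show ?thesis by simp
qed

lemma quad_sum_add: "quad_sum J xs \<omega> K (\<lambda>x. g x + h x) = quad_sum J xs \<omega> K g + quad_sum J xs \<omega> K h"
  by (simp add: quad_sum_def sum.distrib algebra_simps)

lemma quad_sum_diff: "quad_sum J xs \<omega> K (\<lambda>x. g x - h x) = quad_sum J xs \<omega> K g - quad_sum J xs \<omega> K h"
  by (simp add: quad_sum_def sum_subtractf algebra_simps)

lemma quad_sum_cmult: "quad_sum J xs \<omega> K (\<lambda>x. c * g x) = c * quad_sum J xs \<omega> K g"
  by (simp add: quad_sum_def sum_distrib_left algebra_simps)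

text \<open>The quadrature rule is exact on squares of the polynomial space, so the energy is a finite sum
  of point values and can be differentiated in time term by term.\<close>

lemma energy_has_derivative:
  assumes quad: "quadrature_rule q C M J xs \<omega>" and fin: "finite M"
    and F: "\<And>s. (F has_real_derivative f s) (at s)"
    and u: "C1_curve q M u" and v: "C1_curve q M v" and w: "C1_curve q M w" and t: "t \<ge> 0"
  shows "(energy M J xs \<omega> F u v w has_real_derivative
     (\<Sum>K\<in>M. elem_integral K (\<lambda>x. dt v t x * v t x) + elem_integral K (\<lambda>x. dt w t x * w t x)
        + elem_integral K (\<lambda>x. dt u t x * u t x) + quad_sum J xs \<omega> K (\<lambda>x. f (u t x) * dt u t x)))
     (at t within {0..})"
proof -
  let ?e = "\<lambda>s x. 1/2 * (v s x)\<^sup>2 + 1/2 * (w s x)\<^sup>2 + 1/2 * (u s x)\<^sup>2 + F (u s x)"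
  let ?e' = "\<lambda>x. dt v t x * v t x + dt w t x * w t x + dt u t x * u t x + f (u t x) * dt u t x"
  have node: "xs K j \<in> elem K" if "K \<in> M" "j \<in> J K" for K j
    using quad that by (simp add: quadrature_rule_def)
  have Vh: "u s \<in> Vh q M" "v s \<in> Vh q M" "w s \<in> Vh q M"
    "dt u s \<in> Vh q M" "dt v s \<in> Vh q M" "dt w s \<in> Vh q M" if "s \<ge> 0" for s
    using u v w that by (auto simp: C1_curve_def)
  note exact = quad_sum_mult[OF quad]
  have energy: "energy M J xs \<omega> F u v w s = (\<Sum>K\<in>M. quad_sum J xs \<omega> K (?e s))" if s: "s \<ge> 0" for s
    unfolding energy_def
  proof (intro sum.cong refl)
    fix K assume K: "K \<in> M"
    have "elem_integral K (\<lambda>x. 1/2 * (v s x)\<^sup>2 + 1/2 * (w s x)\<^sup>2 + 1/2 * (u s x)\<^sup>2)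
      = 1/2 * elem_integral K (\<lambda>x. v s x * v s x) + 1/2 * elem_integral K (\<lambda>x. w s x * w s x)
        + 1/2 * elem_integral K (\<lambda>x. u s x * u s x)"
      unfolding elem_integral_cmult[symmetric] power2_eq_square
      by (simp only: poly_on_elem_integral_add poly_on_intros Vh[OF s, THEN poly_on_Vh, OF K])
    then show "elem_integral K (\<lambda>x. 1/2 * (v s x)\<^sup>2 + 1/2 * (w s x)\<^sup>2 + 1/2 * (u s x)\<^sup>2)
        + quad_sum J xs \<omega> K (\<lambda>x. F (u s x)) = quad_sum J xs \<omega> K (?e s)"
      by (simp only: quad_sum_add quad_sum_cmult power2_eq_square exact[OF K] Vh[OF s])
  qed
  have "((\<lambda>s. \<Sum>K\<in>M. quad_sum J xs \<omega> K (?e s)) has_real_derivative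
      (\<Sum>K\<in>M. quad_sum J xs \<omega> K ?e')) (at t within {0..})"
    unfolding quad_sum_def
  proof (intro DERIV_sum DERIV_cmult)
    fix K j assume K: "K \<in> M" and j: "j \<in> J K"
    note d = C1_curve_has_derivative[OF _ K node[OF K j] t]
    have "((\<lambda>s. F (u s (xs K j))) has_real_derivative f (u t (xs K j)) * dt u t (xs K j)) (at t within {0..})"
      by (rule DERIV_chain2[OF F d[OF u]])
    then show "((\<lambda>s. ?e s (xs K j)) has_real_derivative ?e' (xs K j)) (at t within {0..})"
      by (auto intro!: derivative_eq_intros d[OF u] d[OF v] d[OF w])
  qed
  \<comment> \<open>Back from point values to integrals: each quadratic term is a product of two
    members of \<open>Vh\<close>, where the rule is exact; the nonlinear term stays a quadrature
    sum.\<close>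
  also have "(\<Sum>K\<in>M. quad_sum J xs \<omega> K ?e') =
     (\<Sum>K\<in>M. elem_integral K (\<lambda>x. dt v t x * v t x) + elem_integral K (\<lambda>x. dt w t x * w t x)
        + elem_integral K (\<lambda>x. dt u t x * u t x) + quad_sum J xs \<omega> K (\<lambda>x. f (u t x) * dt u t x))"
    by (intro sum.cong refl) (simp only: quad_sum_add exact Vh[OF t])
  \<comment> \<open>The two expressions for the energy are known to agree at nonnegative times,
    which is all that a derivative within \<open>{0..}\<close> sees; the radius 1 is
    arbitrary.\<close>
  finally show ?thesis
    by (rule has_field_derivative_transform_within[of _ _ _ _ 1]) (use energy t in auto)
qed

text \<open>The scheme is tested with the solution itself; the nonlinear quadrature terms cancel because
  \<open>f_quot f z * z = f z\<close>, also at \<open>z = 0\<close>.\<close>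

lemma dg_solution_energy_balance:
  assumes sol: "dg_solution \<Omega> M q P J xs \<omega> f \<mu> u v w" and K: "K \<in> M" and t: "t \<ge> 0" and f0: "f 0 = 0"
    and u: "C1_curve q M u" and v: "C1_curve q M v" and w: "C1_curve q M w"
  shows "elem_integral K (\<lambda>x. dt v t x * v t x) + elem_integral K (\<lambda>x. dt w t x * w t x)
        + elem_integral K (\<lambda>x. dt u t x * u t x) + quad_sum J xs \<omega> K (\<lambda>x. f (u t x) * dt u t x)
     = - elem_integral K (\<lambda>x. \<mu> * (v t x)\<^sup>2)
       - (B1 \<Omega> M P (v t) (w t) K (w t) + B2 \<Omega> M P (v t) (w t) K (v t))"
proof -
  have Vh: "u t \<in> Vh q M" "v t \<in> Vh q M" "w t \<in> Vh q M"
    "dt u t \<in> Vh q M" "dt v t \<in> Vh q M" "dt w t \<in> Vh q M"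
    using u v w t by (auto simp: C1_curve_def)
  note poly = Vh[THEN poly_on_Vh, OF K] poly_on_intros
  have eqs:
    "elem_integral K (\<lambda>x. u t x * (dt u t x - v t x))
       + quad_sum J xs \<omega> K (\<lambda>x. f_quot f (u t x) * u t x * (dt u t x - v t x)) = 0"
    "elem_integral K (\<lambda>x. dt w t x * w t x) + B1 \<Omega> M P (v t) (w t) K (w t) = 0"
    "elem_integral K (\<lambda>x. dt v t x * v t x + u t x * v t x + \<mu> * v t x * v t x)
       + quad_sum J xs \<omega> K (\<lambda>x. v t x * f (u t x)) + B2 \<Omega> M P (v t) (w t) K (v t) = 0"
    using sol K t Vh(1-3) unfolding dg_solution_def by blast+
  \<comment> \<open>The first equation will trade the rate of the \<open>u\<close> part of the
    energy for the integral of \<open>u * v\<close>, which then cancels against the same integral in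
    the third equation.\<close>
  have "elem_integral K (\<lambda>x. u t x * (dt u t x - v t x))
      = elem_integral K (\<lambda>x. dt u t x * u t x - u t x * v t x)"
    by (simp add: algebra_simps)
  also have "\<dots> = elem_integral K (\<lambda>x. dt u t x * u t x) - elem_integral K (\<lambda>x. u t x * v t x)"
    by (simp only: poly_on_elem_integral_diff poly)
  finally have 1: "elem_integral K (\<lambda>x. u t x * (dt u t x - v t x))
      = elem_integral K (\<lambda>x. dt u t x * u t x) - elem_integral K (\<lambda>x. u t x * v t x)" .
  have "f_quot f z * z = f z" for z
    using f0 by (simp add: f_quot_def)
  then have 2: "quad_sum J xs \<omega> K (\<lambda>x. f_quot f (u t x) * u t x * (dt u t x - v t x))
      = quad_sum J xs \<omega> K (\<lambda>x. f (u t x) * dt u t x) - quad_sum J xs \<omega> K (\<lambda>x. v t x * f (u t x))"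
    unfolding quad_sum_diff[symmetric] by (simp add: algebra_simps)
  have "elem_integral K (\<lambda>x. dt v t x * v t x + u t x * v t x + \<mu> * v t x * v t x)
      = elem_integral K (\<lambda>x. dt v t x * v t x) + elem_integral K (\<lambda>x. u t x * v t x)
        + elem_integral K (\<lambda>x. \<mu> * v t x * v t x)"
    by (simp only: poly_on_elem_integral_add poly)
  with eqs 1 2 show ?thesis
    by (simp add: power2_eq_square mult.assoc)
qed

text \<open>At 0 only a one-sided derivative is available. Restricting the derivatives from
  \<open>{0..}\<close> to \<open>{0..t}\<close> puts them in the form that the mean value theorem
  accepts.\<close>

lemma has_real_derivative_nonpos_imp_le:
  fixes e :: "real \<Rightarrow> real"
  assumes "\<And>t. t \<ge> 0 \<Longrightarrow> \<exists>d\<le>0. (e has_real_derivative d) (at t within {0..})" and t: "t \<ge> 0"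
  shows "e t \<le> e 0"
proof -
  obtain d where d: "\<And>s. s \<ge> 0 \<Longrightarrow> d s \<le> 0" "\<And>s. s \<ge> 0 \<Longrightarrow> (e has_real_derivative d s) (at s within {0..})"
    using assms(1) by metis
  have "(e has_derivative (*) (d s)) (at s within {0..t})" if "0 \<le> s" for s
    using has_field_derivative_subset[OF d(2)[OF that], of "{0..t}"] by (auto simp: has_field_derivative_def)
  then obtain s where "s \<in> {0..t}" "e t - e 0 = d s * (t - 0)"
    using mvt_very_simple[OF t, of e "\<lambda>s. (*) (d s)"] by blast
  then show ?thesis
    using d(1)[of s] t mult_nonpos_nonneg[of "d s" t] by simp
qed

theorem theorem1:
  fixes \<Omega> :: "'a::euclidean_space set"
    and M :: "'a cell set"
    and q :: nat
    and \<sigma> C \<mu> :: real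
    and J :: "'a cell \<Rightarrow> 'j set"
    and xs :: "'a cell \<Rightarrow> 'j \<Rightarrow> 'a"
    and \<omega> :: "'a cell \<Rightarrow> 'j \<Rightarrow> real"
    and f F :: "real \<Rightarrow> real"
    and P :: flux_params
    and u v w :: "real \<Rightarrow> 'a \<Rightarrow> real"
  assumes "DIM('a) = 1 \<or> DIM('a) = 2"
    and "cartesian_mesh \<Omega> M"
    and "shape_regular \<sigma> M"
    and "q \<ge> 1"
    and "\<mu> \<ge> 0"
    and "quadrature_rule q C M J xs \<omega>"
    and "smooth f"
    and "f 0 = 0"
    and "\<exists>l. ((\<lambda>s. f s / s) \<longlongrightarrow> l) (at 0)"
    and "\<And>s. (F has_real_derivative f s) (at s)"
    and "\<And>s. F s \<ge> 0"
    and "(\<gamma>\<^sub>1 P, \<gamma>\<^sub>2 P, \<kappa>\<^sub>1 P, \<kappa>\<^sub>2 P) \<in> {(0, 1, 1, 0), (1, 1, 0, 0), (0, 0, 1, 1), (1, 0, 0, 1)}"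
    and "C1_curve q M u"
    and "C1_curve q M v"
    and "C1_curve q M w"
    and "dg_solution \<Omega> M q P J xs \<omega> f \<mu> u v w"
  shows "(\<forall>t\<ge>0. (energy M J xs \<omega> F u v w has_real_derivative
            - (\<Sum>K\<in>M. elem_integral K (\<lambda>x. \<mu> * (v t x)\<^sup>2))
            - (\<Sum>(L, R, i)\<in>interior_faces M. face_integral L i 1
                 (\<lambda>x. \<tau>\<^sub>1 P * (norm (jump L R i (v t) x))\<^sup>2
                    + \<beta>\<^sub>1 P * (vjump L R i (grad (w t)) x)\<^sup>2
                    + \<beta>\<^sub>2 P * (norm (jump L R i (w t) x))\<^sup>2
                    + \<tau>\<^sub>2 P * (vjump L R i (grad (v t)) x)\<^sup>2))
            - (\<Sum>(K, i, s)\<in>boundary_faces \<Omega> M. face_integral K i s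
                 (\<lambda>x. \<nu>\<^sub>1 P * ((\<kappa>\<^sub>1 P)\<^sup>2 - (\<gamma>\<^sub>1 P)\<^sup>2) * (zeta1 P K i s (v t) (w t) x)\<^sup>2
                    + \<nu>\<^sub>2 P * ((\<gamma>\<^sub>2 P)\<^sup>2 - (\<kappa>\<^sub>2 P)\<^sup>2) * (zeta2 P K i s (v t) (w t) x)\<^sup>2)))
          (at t within {0..}))
       \<and> (\<tau>\<^sub>1 P \<ge> 0 \<and> \<beta>\<^sub>1 P \<ge> 0 \<and> \<tau>\<^sub>2 P \<ge> 0 \<and> \<beta>\<^sub>2 P \<ge> 0 \<and>
          \<nu>\<^sub>1 P * ((\<kappa>\<^sub>1 P)\<^sup>2 - (\<gamma>\<^sub>1 P)\<^sup>2) \<ge> 0 \<and> \<nu>\<^sub>2 P * ((\<gamma>\<^sub>2 P)\<^sup>2 - (\<kappa>\<^sub>2 P)\<^sup>2) \<ge> 0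
          \<longrightarrow> (\<forall>t\<ge>0. energy M J xs \<omega> F u v w t \<le> energy M J xs \<omega> F u v w 0))"
    (is "(\<forall>t\<ge>0. (?E has_real_derivative - ?vol t - ?int t - ?bd t) _) \<and> (?pos \<longrightarrow> _)")
proof -
  have fin: "finite M"
    using cartesian_meshE[OF assms(2)] by metis
  have deriv: "(?E has_real_derivative - ?vol t - ?int t - ?bd t) (at t within {0..})" if t: "t \<ge> 0" for t
  proof -
    have "v t \<in> Vh q M" "w t \<in> Vh q M"
      using assms(14,15) t by (auto simp: C1_curve_def)
    note flux = sum_B1_plus_B2[OF assms(2) this assms(12)]
    show ?thesis
      using energy_has_derivative[OF assms(6) fin assms(10,13-15) t]
      by (rule DERIV_cong)
         (simp only: dg_solution_energy_balance[OF assms(16) _ t assms(8,13-15)] sum_subtractf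
            sum_negf flux diff_diff_eq cong: sum.cong)
  qed
  moreover have "?E t \<le> ?E 0" if pos: ?pos and t: "t \<ge> 0" for t
  proof (rule has_real_derivative_nonpos_imp_le[OF _ t])
    fix t :: real assume "t \<ge> 0"
    moreover have "?vol t \<ge> 0"
      using assms(5) by (auto simp: elem_integral_def set_lebesgue_integral_def
        intro!: sum_nonneg Bochner_Integration.integral_nonneg)
    moreover have "?int t \<ge> 0" "?bd t \<ge> 0"
      using pos by (auto intro!: sum_nonneg face_integral_nonneg add_nonneg_nonneg)
    ultimately show "\<exists>d\<le>0. (?E has_real_derivative d) (at t within {0..})"
      using deriv by (intro exI[of _ "- ?vol t - ?int t - ?bd t"]) auto
  qed
  ultimately show ?thesis
    by blast
qed

end
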